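(* Let $E$ be a countable set and let $A$ be an operator on $\mathcal H_0=l^2(E)$ satisfying hypothesis (H) (stated in the context). Put $K:=A(I+A)^{-1}$ and let $\mu$ be the determinantal point process on $E$ corresponding to $K$. Let $x_0\in E$ and let $\xi\subset E$ be a configuration with $x_0\notin\xi$. For finite $\Lambda\subset E$ with $x_0\in\Lambda$, let $$\alpha_{[\Lambda]}:=\frac{\mu(\{\zeta:\zeta\cap\Lambda=\{x_0\}\cup\xi_\Lambda\})}{\mu(\{\zeta:\zeta\cap\Lambda=\xi_\Lambda\})}=\frac{\det\big(A_{[\Lambda]}(x,y)\big)_{x,y\in\{x_0\}\cup\xi_\Lambda}}{\det\big(A_{[\Lambda]}(x,y)\big)_{x,y\in\xi_\Lambda}},\qquad \xi_\Lambda:=\xi\cap\Lambda .$$ Then $$\lim_{\Lambda\uparrow E}\alpha_{[\Lambda]}=\alpha,\qquad\text{where}\quad \alpha:=\lim_{\Lambda\uparrow E}\ \inf_{f\in\mathsf F_{\mathrm{loc},\Lambda\cap \xi}}\|e_{x_0}-f\|_-^2 .$$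
   Context: $E$ is a countable set; $\mathcal H_0:=l^2(E)$ is the complex Hilbert space with inner product $(f,g)_0=\sum_{x\in E}\overline{f(x)}g(x)$, and $\{e_x:x\in E\}$ is its usual orthonormal basis. Let $A$ be a bounded Hermitian positive definite linear operator on $\mathcal H_0$ (i.e. $(f,Af)_0\ge 0$ for all $f$) with $\ker A=\{0\}$. $\mathcal H_-$ is the completion of $\mathcal H_0$ with respect to the norm $\|f\|_-$ given by $\|f\|_-^2:=(f,Af)_0$. $\mathcal H_-$ is said to be functionally completed if the completion $\mathcal H_-$ of $(\mathcal H_0,\|\cdot\|_-)$ is obtained by adjoining functions on $E$ to $\mathcal H_0$ (so $\mathcal H_-$ is a Hilbert space of functions on $E$) in such a way that for every $y\in E$ the evaluation $f\mapsto f(y)$ is continuous on $\mathcal H_-$. Equivalently: (i) for every $y\in E$, $f\mapsto f(y)$ is continuous on $(\mathcal H_0,\|\cdot\|_-)$; (ii) every $\|\cdot\|_-$-Cauchy sequence $\{f_n\}\subset\mathcal H_0$ with $f_n(y)\to0$ for every $y\in E$ satisfies $\|f_n\|_-\to0$. Hypothesis (H): the Hermitian positive definite linear operator $A$ on $\mathcal H_0$ is bounded and satisfies (i) $\ker A=\{0\}$; (ii) $\mathcal H_-$ is functionally completed. For $\Delta\subset E$, $\mathsf F_{\mathrm{loc},\Delta}$ is the set of finite linear combinations of $\{e_x:x\in\Delta\}$. The limit $\Lambda\uparrow E$ is taken as $\Lambda$ increases to $E$ through finite subsets; the infimum defining $\alpha$ is nonincreasing in $\Lambda$, so the limit defining $\alpha$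 exists. Configuration space: $\mathcal X$ is the set of all subsets of $E$, identified with $\{0,1\}^E$ with the product topology and Borel $\sigma$-algebra. For a Hermitian bounded operator $K$ on $l^2(E)$ with $0\le K\le I$, the determinantal point process corresponding to $K$ is the unique Borel probability measure $\mu$ on $\mathcal X$ with $\mu(\{\xi\in\mathcal X:\xi\supset X\})=\det(K(x,y))_{x,y\in X}$ for every finite $X\subset E$, where $K(x,y)=(e_x,Ke_y)_0$. For finite $\Lambda\subset E$, $P_\Lambda$ is the orthogonal projection of $l^2(E)$ onto $l^2(\Lambda)$, $K_\Lambda:=P_\Lambda KP_\Lambda$ (as an operator on $l^2(\Lambda)$), $I_\Lambda$ is the identity on $l^2(\Lambda)$, $A_{[\Lambda]}:=K_\Lambda(I_\Lambda-K_\Lambda)^{-1}$, and $A_{[\Lambda]}(x,y)$ are its matrix entries. The determinant of an empty matrix is $1$. One has $\mu(\{\zeta:\zeta\cap\Lambda=\xi_\Lambda\})=\det(I_\Lambda-K_\Lambda)\det(A_{[\Lambda]}(x,y))_{x,y\in\xi_\Lambda}$. *)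

theory Defs
  imports "HOL-Probability.Probability"
begin

section \<open>The space of square-summable functions on a set\<close>

text \<open>
  A function on \<open>E\<close> is represented by a function on the whole type that vanishes outside \<open>E\<close>;
  this makes the representation unique. For \<open>\<Lambda> \<subseteq> E\<close> the set \<open>l2 \<Lambda>\<close> is then literally a subset
  of \<open>l2 E\<close>.
\<close>

definition l2 :: "'a set \<Rightarrow> ('a \<Rightarrow> complex) set" where
  "l2 E = {f. (\<forall>x. x \<notin> E \<longrightarrow> f x = 0) \<and> (\<lambda>x. (cmod (f x))\<^sup>2) summable_on E}"

definition l2_inner :: "'a set \<Rightarrow> ('a \<Rightarrow> complex) \<Rightarrow> ('a \<Rightarrow> complex) \<Rightarrow> complex" where
  "l2_inner E f g = (\<Sum>\<^sub>\<infinity>x\<in>E. cnj (f x) * g x)"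

definition l2_norm :: "'a set \<Rightarrow> ('a \<Rightarrow> complex) \<Rightarrow> real" where
  "l2_norm E f = sqrt (\<Sum>\<^sub>\<infinity>x\<in>E. (cmod (f x))\<^sup>2)"

definition basis_fun :: "'a \<Rightarrow> 'a \<Rightarrow> complex" where
  "basis_fun x = (\<lambda>y. if y = x then 1 else 0)"

section \<open>Operators\<close>

text \<open>
  An operator on \<open>l2 E\<close> is a function on the ambient function type; only its values on \<open>l2 E\<close>
  are ever constrained or used.
\<close>

definition bounded_op :: "'a set \<Rightarrow> (('a \<Rightarrow> complex) \<Rightarrow> ('a \<Rightarrow> complex)) \<Rightarrow> bool" where
  "bounded_op E A \<longleftrightarrow>
     (\<forall>f\<in>l2 E. A f \<in> l2 E) \<and>
     (\<forall>f\<in>l2 E. \<forall>g\<in>l2 E. A (\<lambda>x. f x + g x) = (\<lambda>x. A f x + A g x)) \<and>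
     (\<forall>c. \<forall>f\<in>l2 E. A (\<lambda>x. c * f x) = (\<lambda>x. c * A f x)) \<and>
     (\<exists>C. \<forall>f\<in>l2 E. l2_norm E (A f) \<le> C * l2_norm E f)"

definition hermitian_op :: "'a set \<Rightarrow> (('a \<Rightarrow> complex) \<Rightarrow> ('a \<Rightarrow> complex)) \<Rightarrow> bool" where
  "hermitian_op E A \<longleftrightarrow> (\<forall>f\<in>l2 E. \<forall>g\<in>l2 E. l2_inner E f (A g) = l2_inner E (A f) g)"

definition positive_op :: "'a set \<Rightarrow> (('a \<Rightarrow> complex) \<Rightarrow> ('a \<Rightarrow> complex)) \<Rightarrow> bool" where
  "positive_op E A \<longleftrightarrow> (\<forall>f\<in>l2 E. l2_inner E f (A f) \<in> \<real>\<^sub>\<ge>\<^sub>0)"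

definition ker_op :: "'a set \<Rightarrow> (('a \<Rightarrow> complex) \<Rightarrow> ('a \<Rightarrow> complex)) \<Rightarrow> ('a \<Rightarrow> complex) set" where
  "ker_op E A = {f \<in> l2 E. A f = (\<lambda>_. 0)}"

definition op_entry ::
  "'a set \<Rightarrow> (('a \<Rightarrow> complex) \<Rightarrow> ('a \<Rightarrow> complex)) \<Rightarrow> 'a \<Rightarrow> 'a \<Rightarrow> complex" where
  "op_entry E T x y = l2_inner E (basis_fun x) (T (basis_fun y))"

section \<open>The completion with respect to the weaker norm\<close>

definition minus_norm ::
  "'a set \<Rightarrow> (('a \<Rightarrow> complex) \<Rightarrow> ('a \<Rightarrow> complex)) \<Rightarrow> ('a \<Rightarrow> complex) \<Rightarrow> real" where
  "minus_norm E A f = sqrt (Re (l2_inner E f (A f)))"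

text \<open>
  \<open>function_completion E A H N\<close>: the normed space \<open>(H, N)\<close> consists of functions on \<open>E\<close>, with the
  pointwise linear structure, and is a completion of \<open>l2 E\<close> under \<open>minus_norm E A\<close>, the
  embedding of \<open>l2 E\<close> being the inclusion. (The parallelogram law passes from the dense subspace
  to \<open>H\<close>, so \<open>H\<close> is a Hilbert space.) The triangle inequality and definiteness of \<open>N\<close> are the
  metric axioms for \<open>N (f - g)\<close>.
\<close>

definition function_completion ::
  "'a set \<Rightarrow> (('a \<Rightarrow> complex) \<Rightarrow> ('a \<Rightarrow> complex)) \<Rightarrow>
   ('a \<Rightarrow> complex) set \<Rightarrow> (('a \<Rightarrow> complex) \<Rightarrow> real) \<Rightarrow> bool" where
  "function_completion E A H N \<longleftrightarrow>
     l2 E \<subseteq> H \<and>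
     (\<forall>f\<in>H. \<forall>x. x \<notin> E \<longrightarrow> f x = 0) \<and>
     (\<forall>f\<in>H. \<forall>g\<in>H. (\<lambda>x. f x + g x) \<in> H) \<and>
     (\<forall>c. \<forall>f\<in>H. (\<lambda>x. c * f x) \<in> H \<and> N (\<lambda>x. c * f x) = cmod c * N f) \<and>
     Metric_space H (\<lambda>f g. N (\<lambda>x. f x - g x)) \<and>
     (\<forall>f\<in>l2 E. N f = minus_norm E A f) \<and>
     Metric_space.mcomplete H (\<lambda>f g. N (\<lambda>x. f x - g x)) \<and>
     Metric_space.mtopology H (\<lambda>f g. N (\<lambda>x. f x - g x)) closure_of l2 E = H"

definition functionally_completed ::
  "'a set \<Rightarrow> (('a \<Rightarrow> complex) \<Rightarrow> ('a \<Rightarrow> complex)) \<Rightarrow> bool" where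
  "functionally_completed E A \<longleftrightarrow>
     (\<exists>H N. function_completion E A H N \<and>
        (\<forall>y\<in>E. continuous_map (Metric_space.mtopology H (\<lambda>f g. N (\<lambda>x. f x - g x)))
                  euclidean (\<lambda>f. f y)))"

definition hypothesis_H :: "'a set \<Rightarrow> (('a \<Rightarrow> complex) \<Rightarrow> ('a \<Rightarrow> complex)) \<Rightarrow> bool" where
  "hypothesis_H E A \<longleftrightarrow>
     bounded_op E A \<and> hermitian_op E A \<and> positive_op E A \<and>
     ker_op E A = {\<lambda>_. 0} \<and> functionally_completed E A"

section \<open>Determinantal point processes\<close>

text \<open>
  The Leibniz determinant of a matrix indexed by a finite set; it is \<open>1\<close> for the empty set.
\<close>

definition det_on :: "'a set \<Rightarrow> ('a \<Rightarrow> 'a \<Rightarrow> complex) \<Rightarrow> complex" where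
  "det_on X M = (\<Sum>p | p permutes X. of_int (sign p) * (\<Prod>x\<in>X. M x (p x)))"

text \<open>
  The subsets of \<open>E\<close> with the Borel \<open>\<sigma>\<close>-algebra of the product topology on \<open>{0,1}\<^sup>E\<close>, pulled back
  along the bijection sending a subset to its indicator function. Only the space and the
  \<open>\<sigma>\<close>-algebra of this measure are meaningful.
\<close>

definition indicator_topology :: "'a set \<Rightarrow> ('a \<Rightarrow> bool) topology" where
  "indicator_topology E = product_topology (\<lambda>_. discrete_topology UNIV) E"

definition config_space :: "'a set \<Rightarrow> 'a set measure" where
  "config_space E =
     vimage_algebra (Pow E) (\<lambda>\<xi>. \<lambda>x\<in>E. x \<in> \<xi>)
       (sigma (topspace (indicator_topology E)) {U. openin (indicator_topology E) U})"

definition determinantal_process ::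
  "'a set \<Rightarrow> (('a \<Rightarrow> complex) \<Rightarrow> ('a \<Rightarrow> complex)) \<Rightarrow> 'a set measure \<Rightarrow> bool" where
  "determinantal_process E K \<mu> \<longleftrightarrow>
     prob_space \<mu> \<and> sets \<mu> = sets (config_space E) \<and>
     (\<forall>X. finite X \<and> X \<subseteq> E \<longrightarrow>
        complex_of_real (measure \<mu> {\<xi> \<in> Pow E. X \<subseteq> \<xi>}) = det_on X (op_entry E K))"

section \<open>The operators built from \<open>A\<close>\<close>

definition kernel_of ::
  "'a set \<Rightarrow> (('a \<Rightarrow> complex) \<Rightarrow> ('a \<Rightarrow> complex)) \<Rightarrow> ('a \<Rightarrow> complex) \<Rightarrow> ('a \<Rightarrow> complex)" where
  "kernel_of E A = (\<lambda>f. A (inv_into (l2 E) (\<lambda>g x. g x + A g x) f))"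

definition coord_proj :: "'a set \<Rightarrow> ('a \<Rightarrow> complex) \<Rightarrow> ('a \<Rightarrow> complex)" where
  "coord_proj \<Lambda> f = (\<lambda>x. if x \<in> \<Lambda> then f x else 0)"

definition compression ::
  "'a set \<Rightarrow> (('a \<Rightarrow> complex) \<Rightarrow> ('a \<Rightarrow> complex)) \<Rightarrow> ('a \<Rightarrow> complex) \<Rightarrow> ('a \<Rightarrow> complex)" where
  "compression \<Lambda> K = (\<lambda>f. coord_proj \<Lambda> (K (coord_proj \<Lambda> f)))"

definition local_op ::
  "'a set \<Rightarrow> (('a \<Rightarrow> complex) \<Rightarrow> ('a \<Rightarrow> complex)) \<Rightarrow> ('a \<Rightarrow> complex) \<Rightarrow> ('a \<Rightarrow> complex)" where
  "local_op \<Lambda> K =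
     (\<lambda>f. compression \<Lambda> K (inv_into (l2 \<Lambda>) (\<lambda>g x. g x - compression \<Lambda> K g x) f))"

definition local_entry ::
  "'a set \<Rightarrow> (('a \<Rightarrow> complex) \<Rightarrow> ('a \<Rightarrow> complex)) \<Rightarrow> 'a \<Rightarrow> 'a \<Rightarrow> complex" where
  "local_entry \<Lambda> K = op_entry \<Lambda> (local_op \<Lambda> K)"

section \<open>The two quantities compared\<close>

definition cylinder_prob :: "'a set \<Rightarrow> 'a set measure \<Rightarrow> 'a set \<Rightarrow> 'a set \<Rightarrow> real" where
  "cylinder_prob E \<mu> \<Lambda> X = measure \<mu> {\<zeta> \<in> Pow E. \<zeta> \<inter> \<Lambda> = X}"

definition alpha_loc :: "'a set \<Rightarrow> 'a set measure \<Rightarrow> 'a \<Rightarrow> 'a set \<Rightarrow> 'a set \<Rightarrow> real" where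
  "alpha_loc E \<mu> x0 \<xi> \<Lambda> =
     cylinder_prob E \<mu> \<Lambda> ({x0} \<union> (\<xi> \<inter> \<Lambda>)) / cylinder_prob E \<mu> \<Lambda> (\<xi> \<inter> \<Lambda>)"

definition F_loc :: "'a set \<Rightarrow> ('a \<Rightarrow> complex) set" where
  "F_loc \<Delta> = {f. \<exists>S c. finite S \<and> S \<subseteq> \<Delta> \<and> f = (\<lambda>y. \<Sum>x\<in>S. c x * basis_fun x y)}"

definition inf_sq_dist ::
  "'a set \<Rightarrow> (('a \<Rightarrow> complex) \<Rightarrow> ('a \<Rightarrow> complex)) \<Rightarrow> 'a \<Rightarrow> 'a set \<Rightarrow> 'a set \<Rightarrow> real" where
  "inf_sq_dist E A x0 \<xi> \<Lambda> =
     (INF f\<in>F_loc (\<Lambda> \<inter> \<xi>). (minus_norm E A (\<lambda>y. basis_fun x0 y - f y))\<^sup>2)"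

definition alpha ::
  "'a set \<Rightarrow> (('a \<Rightarrow> complex) \<Rightarrow> ('a \<Rightarrow> complex)) \<Rightarrow> 'a \<Rightarrow> 'a set \<Rightarrow> real" where
  "alpha E A x0 \<xi> = Lim (finite_subsets_at_top E) (inf_sq_dist E A x0 \<xi>)"

end

theory Submission
  imports Defs "Jordan_Normal_Form.Determinant"
begin

text \<open>
  Write \<open>K = A (I + A)\<inverse>\<close>, so that \<open>I - K\<close> is the resolvent \<open>(I + A)\<inverse>\<close>. Inclusion-exclusion turns the
  defining identity of the process into \<open>determinantal_cylinder\<close>, and factoring out the finite section
  of the resolvent (\<open>local_entry_eq\<close>) gives the product formula \<open>cylinder_prob_eq\<close>. Hence the ratio
  \<open>\<alpha>\<^sub>\<Lambda>\<close> of cylinder probabilities is a ratio of nested determinants of \<open>A\<^sub>[\<^sub>\<Lambda>\<^sub>]\<close>, that is, a Schur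
  complement.

  The matrix \<open>A\<^sub>[\<^sub>\<Lambda>\<^sub>] = ((I - K)\<^sub>\<Lambda>)\<inverse> - I\<close> is \<open>A\<close> seen from \<open>\<Lambda>\<close>: if \<open>v\<close> lives on \<open>\<Lambda>\<close> and \<open>u\<close> is the
  extension of \<open>v\<close> to \<open>E\<close> with \<open>(I + A) u = 0\<close> off \<open>\<Lambda>\<close>, then \<open>A\<^sub>[\<^sub>\<Lambda>\<^sub>] v\<close> is the restriction of \<open>A u\<close>
  (\<open>local_extension\<close>). The Schur complement is therefore \<open>(A u) x0\<close> for the \<^emph>\<open>equilibrium extension\<close>
  \<open>u\<close>, for which \<open>u x0 = 1\<close>, \<open>u = 0\<close> on \<open>\<Lambda> - (\<xi> \<union> {x0})\<close>, \<open>A u = 0\<close> on \<open>\<xi> \<inter> \<Lambda>\<close> and \<open>(I + A) u = 0\<close> off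
  \<open>\<Lambda>\<close> (\<open>equilibrium\<close>, \<open>alpha_loc_equilibrium\<close>). Pairing \<open>A u\<close> with \<open>u\<close> gives
  \<open>\<alpha>\<^sub>\<Lambda> = \<parallel>u\<parallel>\<^sub>-\<^sup>2 + \<parallel>1\<^sub>E\<^sub>-\<^sub>\<Lambda> u\<parallel>\<^sub>0\<^sup>2\<close> (\<open>equilibrium_value\<close>).

  Upper bound (\<open>equilibrium_value_le\<close>): \<open>u\<close> has the same energy product \<open>\<alpha>\<^sub>\<Lambda>\<close> with every competitor
  \<open>e\<^sub>x\<^sub>0 - f\<close>, where \<open>f\<close> is supported on \<open>\<xi> \<inter> \<Lambda>\<close>, so \<open>\<alpha>\<^sub>\<Lambda>\<close> is at most the energy of each competitor.

  Lower bound (\<open>equilibrium_value_ge\<close>): the formula for \<open>\<alpha>\<^sub>\<Lambda>\<close> bounds the \<open>l\<^sup>2\<close>-norm of the outer part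
  \<open>p = 1\<^sub>E\<^sub>-\<^sub>\<Lambda> u\<close> uniformly in \<open>\<Lambda>\<close>. Fix \<open>r = e\<^sub>x\<^sub>0 - f\<close> of nearly minimal energy. The energy product of
  \<open>r\<close> with \<open>p\<close> equals the \<open>l\<^sup>2\<close>-product of \<open>p\<close> with the restriction of \<open>A r\<close> to \<open>E - \<Lambda>\<close>, and that
  restriction tends to \<open>0\<close> in norm as \<open>\<Lambda>\<close> grows. So in the limit \<open>u\<close> behaves in products with \<open>r\<close> like
  \<open>u - p\<close>, which is itself a competitor; near-minimality makes \<open>r\<close> almost orthogonal to the difference
  \<open>u - p - r\<close>, and \<open>\<alpha>\<^sub>\<Lambda> \<ge> \<parallel>u\<parallel>\<^sub>-\<^sup>2 \<ge> 2 \<langle>r, u\<rangle>\<^sub>- - \<parallel>r\<parallel>\<^sub>-\<^sup>2\<close> is almost \<open>\<parallel>r\<parallel>\<^sub>-\<^sup>2\<close>.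
\<close>

section \<open>Determinants over finite index sets\<close>

text \<open>
  An enumeration of \<open>X\<close> conjugates the permutations of \<open>X\<close> to those of \<open>{0..<n}\<close> without changing signs.
  Every matrix fact below that does not come straight from the Leibniz sum enters through this bridge.
\<close>
lemma det_on_transfer:
  assumes "bij_betw h {0..<n} X"
  shows "det_on X M = det (mat n n (\<lambda>(i, j). M (h i) (h j)))"
proof -
  let ?N = "{0..<n}"
  have inj: "inj_on h ?N" and img: "h ` ?N = X"
    using assms by (auto simp: bij_betw_def)
  have inv_h: "inv_into ?N h (h i) = i" if "i < n" for i
    using inj that by (simp add: inv_into_f_f)
  have h_inv: "h (inv_into ?N h x) = x" "inv_into ?N h x < n" if "x \<in> X" for x
    using img that f_inv_into_f[of x h ?N] inv_into_into[of x h ?N] by auto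
  have bij_inv: "bij_betw (inv_into ?N h) X ?N"
    using assms by (rule bij_betw_inv_into)
  have bij: "bij_betw (map_permutation ?N h) {p. p permutes ?N} {p. p permutes X}"
  proof (rule bij_betw_byWitness[where f' = "map_permutation X (inv_into ?N h)"])
    show "\<forall>p\<in>{p. p permutes ?N}. map_permutation X (inv_into ?N h) (map_permutation ?N h p) = p"
      using map_permutation_compose_inv[OF assms] inv_h by auto
    show "\<forall>p\<in>{p. p permutes X}. map_permutation ?N h (map_permutation X (inv_into ?N h) p) = p"
      using map_permutation_compose_inv[OF bij_inv] h_inv by auto
    show "map_permutation ?N h ` {p. p permutes ?N} \<subseteq> {p. p permutes X}"
      using map_permutation_permutes[OF assms] by auto
    show "map_permutation X (inv_into ?N h) ` {p. p permutes X} \<subseteq> {p. p permutes ?N}"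
      using map_permutation_permutes[OF bij_inv] by auto
  qed
  have "det_on X M = (\<Sum>p | p permutes ?N. of_int (sign (map_permutation ?N h p)) *
      (\<Prod>x\<in>X. M x (map_permutation ?N h p x)))"
    unfolding det_on_def using sum.reindex_bij_betw[OF bij, symmetric] .
  also have "\<dots> = (\<Sum>p | p permutes ?N. of_int (sign p) * (\<Prod>i = 0..<n. M (h i) (h (p i))))"
  proof (intro sum.cong refl, goal_cases)
    case (1 p)
    have "(\<Prod>x\<in>X. M x (map_permutation ?N h p x)) = (\<Prod>i\<in>?N. M (h i) (map_permutation ?N h p (h i)))"
      using prod.reindex_bij_betw[OF assms, symmetric] .
    also have "\<dots> = (\<Prod>i\<in>?N. M (h i) (h (p i)))"
      using map_permutation_apply[OF inj] by (intro prod.cong) auto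
    finally show ?case
      using sign_map_permutation[OF inj] 1 by simp
  qed
  also have "\<dots> = det (mat n n (\<lambda>(i, j). M (h i) (h j)))"
  proof -
    have "p i < n" if "p permutes {0..<n}" "i < n" for p i
      using permutes_in_image[OF that(1), of i] that(2) by simp
    then show ?thesis
      by (subst det_def'[where n = n]) (auto intro!: sum.cong prod.cong)
  qed
  finally show ?thesis .
qed

lemma det_on_cong:
  assumes "\<And>x y. x \<in> X \<Longrightarrow> y \<in> X \<Longrightarrow> M x y = N x y"
  shows "det_on X M = det_on X N"
  unfolding det_on_def using assms by (auto intro!: sum.cong prod.cong simp: permutes_in_image)

lemma det_on_mult:
  assumes "finite X"
  shows "det_on X (\<lambda>x z. \<Sum>y\<in>X. M x y * N y z) = det_on X M * det_on X N"
proof -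
  obtain h and n :: nat where h: "bij_betw h {0..<n} X"
    using ex_bij_betw_nat_finite[OF assms] by blast
  have "mat n n (\<lambda>(i, k). \<Sum>y\<in>X. M (h i) y * N y (h k)) =
      mat n n (\<lambda>(i, j). M (h i) (h j)) * mat n n (\<lambda>(j, k). N (h j) (h k))"
    by (rule eq_matI) (auto simp: scalar_prod_def sum.reindex_bij_betw[OF h, symmetric])
  then show ?thesis
    using det_mult[of "mat n n (\<lambda>(i, j). M (h i) (h j))" n "mat n n (\<lambda>(j, k). N (h j) (h k))"]
    by (simp add: det_on_transfer[OF h])
qed

lemma det_on_transpose:
  assumes "finite X"
  shows "det_on X (\<lambda>x y. M y x) = det_on X M"
proof -
  obtain h and n :: nat where h: "bij_betw h {0..<n} X"
    using ex_bij_betw_nat_finite[OF assms] by blast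
  have "mat n n (\<lambda>(i, j). M (h j) (h i)) = transpose_mat (mat n n (\<lambda>(i, j). M (h i) (h j)))"
    by (rule eq_matI) auto
  then show ?thesis
    using det_transpose[of "mat n n (\<lambda>(i, j). M (h i) (h j))" n]
    by (simp add: det_on_transfer[OF h])
qed

lemma det_on_nonzero_if_injective:
  assumes "finite X"
    and inj: "\<And>v. \<forall>x. x \<notin> X \<longrightarrow> v x = 0 \<Longrightarrow> \<forall>x\<in>X. (\<Sum>y\<in>X. M x y * v y) = 0 \<Longrightarrow> \<forall>x\<in>X. v x = 0"
  shows "det_on X M \<noteq> 0"
proof
  assume 0: "det_on X M = 0"
  obtain h and n :: nat where h: "bij_betw h {0..<n} X"
    using ex_bij_betw_nat_finite[OF assms(1)] by blast
  let ?M = "mat n n (\<lambda>(i, j). M (h i) (h j))"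
  obtain w where w: "w \<in> carrier_vec n" "w \<noteq> 0\<^sub>v n" "?M *\<^sub>v w = 0\<^sub>v n"
    using 0 det_0_iff_vec_prod_zero_field[of ?M n] by (auto simp: det_on_transfer[OF h])
  define v where "v x = (if x \<in> X then vec_index w (inv_into {0..<n} h x) else 0)" for x
  have hX: "h i \<in> X" if "i < n" for i
    using h that by (auto simp: bij_betw_def)
  have vh: "v (h i) = vec_index w i" if "i < n" for i
    using h hX that by (simp add: v_def bij_betw_inv_into_left)
  have "(\<Sum>y\<in>X. M (h i) y * v y) = 0" if "i < n" for i
  proof -
    have "(\<Sum>y\<in>X. M (h i) y * v y) = (\<Sum>j\<in>{0..<n}. M (h i) (h j) * v (h j))"
      by (rule sum.reindex_bij_betw[OF h, symmetric])
    also have "\<dots> = vec_index (?M *\<^sub>v w) i"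
      using that w(1) vh by (auto simp: scalar_prod_def intro!: sum.cong)
    finally show ?thesis
      using w(3) that by simp
  qed
  then have "\<forall>x\<in>X. (\<Sum>y\<in>X. M x y * v y) = 0"
    using h by (auto simp: bij_betw_def)
  then have "\<forall>x\<in>X. v x = 0"
    by (rule inj[rotated]) (simp add: v_def)
  then have "w = 0\<^sub>v n"
    using w(1) vh hX by (intro eq_vecI) auto
  with w(2) show False
    by simp
qed

lemma solve_linear_system_on:
  assumes "finite X" and "det_on X M \<noteq> 0"
  obtains v where "\<And>x. x \<notin> X \<Longrightarrow> v x = 0" and "\<And>x. x \<in> X \<Longrightarrow> (\<Sum>y\<in>X. M x y * v y) = b x"
proof -
  obtain h and n :: nat where h: "bij_betw h {0..<n} X"
    using ex_bij_betw_nat_finite[OF assms(1)] by blast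
  let ?M = "mat n n (\<lambda>(i, j). M (h i) (h j))" and ?b = "vec n (\<lambda>i. b (h i))"
  have "?M \<in> Units (ring_mat TYPE(complex) n ())"
    using assms(2) by (intro det_non_zero_imp_unit) (simp_all add: det_on_transfer[OF h])
  then obtain N where N: "N \<in> carrier_mat n n" "?M * N = 1\<^sub>m n"
    by (auto simp: Units_def ring_mat_def)
  define w where "w = N *\<^sub>v ?b"
  have w: "w \<in> carrier_vec n" "?M *\<^sub>v w = ?b"
    using N assoc_mult_mat_vec[of ?M n n N n ?b] by (auto simp: w_def)
  define v where "v x = (if x \<in> X then vec_index w (inv_into {0..<n} h x) else 0)" for x
  have hX: "h i \<in> X" if "i < n" for i
    using h that by (auto simp: bij_betw_def)
  have vh: "v (h i) = vec_index w i" if "i < n" for i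
    using h hX that by (simp add: v_def bij_betw_inv_into_left)
  have "(\<Sum>y\<in>X. M (h i) y * v y) = b (h i)" if "i < n" for i
  proof -
    have "(\<Sum>y\<in>X. M (h i) y * v y) = (\<Sum>j\<in>{0..<n}. M (h i) (h j) * v (h j))"
      by (rule sum.reindex_bij_betw[OF h, symmetric])
    also have "\<dots> = vec_index (?M *\<^sub>v w) i"
      using that w(1) vh by (auto simp: scalar_prod_def intro!: sum.cong)
    finally show ?thesis
      using w(2) that by simp
  qed
  then have "(\<Sum>y\<in>X. M x y * v y) = b x" if "x \<in> X" for x
    using h that by (auto simp: bij_betw_def)
  then show thesis
    by (intro that[of v]) (auto simp: v_def)
qed

lemma det_on_row_add:
  assumes "finite X" and "a \<in> X"
    and "\<And>y. y \<in> X \<Longrightarrow> L a y = M a y + N a y"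
    and "\<And>x y. x \<in> X \<Longrightarrow> y \<in> X \<Longrightarrow> x \<noteq> a \<Longrightarrow> L x y = M x y"
    and "\<And>x y. x \<in> X \<Longrightarrow> y \<in> X \<Longrightarrow> x \<noteq> a \<Longrightarrow> L x y = N x y"
  shows "det_on X L = det_on X M + det_on X N"
proof -
  have "(\<Prod>x\<in>X. L x (p x)) = (\<Prod>x\<in>X. M x (p x)) + (\<Prod>x\<in>X. N x (p x))" if p: "p permutes X" for p
  proof -
    have pX: "p x \<in> X" if "x \<in> X" for x
      using p that by (simp add: permutes_in_image)
    have "(\<Prod>x\<in>X - {a}. L x (p x)) = (\<Prod>x\<in>X - {a}. M x (p x))"
      by (rule prod.cong) (use assms(4) pX in auto)
    moreover have "(\<Prod>x\<in>X - {a}. L x (p x)) = (\<Prod>x\<in>X - {a}. N x (p x))"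
      by (rule prod.cong) (use assms(5) pX in auto)
    ultimately show ?thesis
      using assms(1-3) pX by (simp add: prod.remove[of X a] distrib_right)
  qed
  then show ?thesis
    by (simp add: det_on_def sum.distrib[symmetric] algebra_simps)
qed

text \<open>
  Only permutations fixing \<open>a\<close> contribute to the Leibniz sum, and these are the permutations of \<open>X\<close>.
\<close>
lemma det_on_insert_row:
  assumes "finite X" and "a \<notin> X" and "\<And>y. y \<in> X \<Longrightarrow> M a y = 0"
  shows "det_on (insert a X) M = M a a * det_on X M"
proof -
  have "det_on (insert a X) M = (\<Sum>p | p permutes X. of_int (sign p) * (\<Prod>x\<in>insert a X. M x (p x)))"
    unfolding det_on_def
  proof (rule sum.mono_neutral_right)
    show "finite {p. p permutes insert a X}"
      using assms(1) by (simp add: finite_permutations)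
    show "{p. p permutes X} \<subseteq> {p. p permutes insert a X}"
      by (auto intro: permutes_subset)
    show "\<forall>p\<in>{p. p permutes insert a X} - {p. p permutes X}.
        of_int (sign p) * (\<Prod>x\<in>insert a X. M x (p x)) = 0"
    proof
      fix p assume p: "p \<in> {p. p permutes insert a X} - {p. p permutes X}"
      have "p a \<noteq> a"
        using p permutes_superset[of p "insert a X" X] by blast
      moreover have "p a \<in> insert a X"
        using p permutes_in_image[of p "insert a X" a] by simp
      ultimately have "M a (p a) = 0"
        using assms(3) by auto
      then show "of_int (sign p) * (\<Prod>x\<in>insert a X. M x (p x)) = 0"
        using assms(1) by (auto intro: prod_zero)
    qed
  qed
  also have "\<dots> = (\<Sum>p | p permutes X. M a a * (of_int (sign p) * (\<Prod>x\<in>X. M x (p x))))"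
    using assms(1,2) by (intro sum.cong) (auto simp: permutes_not_in)
  finally show ?thesis
    by (simp add: det_on_def sum_distrib_left)
qed

lemma det_on_insert_column:
  assumes "finite X" and "a \<notin> X" and "\<And>x. x \<in> X \<Longrightarrow> M x a = 0"
  shows "det_on (insert a X) M = M a a * det_on X M"
  using det_on_insert_row[of X a "\<lambda>x y. M y x"] det_on_transpose[of _ M] assms by simp

lemma det_on_identity_columns:
  assumes "finite Y" and "finite X" and "X \<inter> Y = {}"
  shows "det_on (X \<union> Y) (\<lambda>x y. if y \<in> X then M x y else of_bool (x = y)) = det_on X M"
  using assms(1,3)
proof (induction Y)
  case empty
  show ?case by (auto intro: det_on_cong)
next
  case (insert a Y)
  have "det_on (insert a (X \<union> Y)) (\<lambda>x y. if y \<in> X then M x y else of_bool (x = y)) =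
      det_on (X \<union> Y) (\<lambda>x y. if y \<in> X then M x y else of_bool (x = y))"
    by (subst det_on_insert_column) (use assms(2) insert in auto)
  then show ?case
    using insert by simp
qed

text \<open>
  Replacing column \<open>a\<close> of \<open>M\<close> by \<open>M v\<close> is right multiplication by a matrix of determinant \<open>v a = 1\<close>; the
  new column vanishes off \<open>a\<close>. The factor \<open>(M v) a\<close> is the Schur complement of the block over \<open>X\<close>.
\<close>
lemma det_on_insert_schur:
  assumes "finite X" and "a \<notin> X" and "v a = 1"
    and "\<And>x. x \<in> X \<Longrightarrow> (\<Sum>y\<in>insert a X. M x y * v y) = 0"
  shows "det_on (insert a X) M = (\<Sum>y\<in>insert a X. M a y * v y) * det_on X M"
proof -
  let ?V = "\<lambda>x y. if y = a then v x else of_bool (x = y)"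
  let ?MV = "\<lambda>x z. \<Sum>y\<in>insert a X. M x y * ?V y z"
  have "det_on (insert a X) ?V = det_on X ?V"
    by (subst det_on_insert_row) (use assms in auto)
  also have "\<dots> = det_on ({} \<union> X) (\<lambda>x y. if y \<in> {} then 0 else of_bool (x = y))"
    using assms(2) by (auto intro: det_on_cong)
  also have "\<dots> = 1"
    by (subst det_on_identity_columns) (use assms(1) in \<open>auto simp: det_on_def\<close>)
  finally have "det_on (insert a X) M = det_on (insert a X) ?MV"
    using det_on_mult[of "insert a X" M ?V] assms(1) by simp
  also have "\<dots> = ?MV a a * det_on X ?MV"
    by (rule det_on_insert_column) (use assms in auto)
  also have "det_on X ?MV = det_on X M"
  proof (rule det_on_cong)
    fix x y assume xy: "x \<in> X" "y \<in> X"
    then have "?MV x y = (\<Sum>z\<in>insert a X. if z = y then M x z else 0)"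
      using assms(2) by (intro sum.cong) auto
    then show "?MV x y = M x y"
      using xy assms(1) by simp
  qed
  finally show ?thesis
    by simp
qed

lemma det_on_column_add:
  assumes "finite X" and "a \<in> X"
    and "\<And>x. x \<in> X \<Longrightarrow> L x a = M x a + N x a"
    and "\<And>x y. x \<in> X \<Longrightarrow> y \<in> X \<Longrightarrow> y \<noteq> a \<Longrightarrow> L x y = M x y"
    and "\<And>x y. x \<in> X \<Longrightarrow> y \<in> X \<Longrightarrow> y \<noteq> a \<Longrightarrow> L x y = N x y"
  shows "det_on X L = det_on X M + det_on X N"
proof -
  have "det_on X (\<lambda>x y. L y x) = det_on X (\<lambda>x y. M y x) + det_on X (\<lambda>x y. N y x)"
    by (rule det_on_row_add[of X a]) (use assms in auto)
  then show ?thesis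
    unfolding det_on_transpose[OF assms(1), of L] det_on_transpose[OF assms(1), of M]
      det_on_transpose[OF assms(1), of N] .
qed

section \<open>Square-summable functions\<close>

text \<open>
  Suprema over finite sets describe both membership in \<open>l2\<close> and the norm, so that the triangle inequality
  and limits of norms can be taken from finite sums.
\<close>
lemma l2_memI_bounded:
  assumes "\<And>x. x \<notin> E \<Longrightarrow> f x = 0"
    and "\<And>S. finite S \<Longrightarrow> S \<subseteq> E \<Longrightarrow> L2_set (\<lambda>x. cmod (f x)) S \<le> c"
  shows "f \<in> l2 E" and "l2_norm E f \<le> c"
proof -
  have c: "0 \<le> c"
    using assms(2)[of "{}"] by simp
  have bound: "(\<Sum>x\<in>S. (cmod (f x))\<^sup>2) \<le> c\<^sup>2" if "finite S" "S \<subseteq> E" for S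
    using assms(2)[OF that] c by (simp add: L2_set_def sqrt_le_D)
  have summable: "(\<lambda>x. (cmod (f x))\<^sup>2) summable_on E"
    by (rule nonneg_bdd_above_summable_on) (auto intro!: bdd_aboveI2 bound)
  then show "f \<in> l2 E"
    using assms(1) by (simp add: l2_def)
  have "(\<Sum>\<^sub>\<infinity>x\<in>E. (cmod (f x))\<^sup>2) \<le> c\<^sup>2"
    by (rule infsum_le_finite_sums[OF summable bound])
  then show "l2_norm E f \<le> c"
    using c by (simp add: l2_norm_def real_le_lsqrt infsum_nonneg)
qed

lemma L2_set_le_l2_norm:
  assumes "f \<in> l2 E" and "finite S" and "S \<subseteq> E"
  shows "L2_set (\<lambda>x. cmod (f x)) S \<le> l2_norm E f"
  unfolding L2_set_def l2_norm_def
  using assms by (intro real_sqrt_le_mono finite_sum_le_infsum) (auto simp: l2_def)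

lemma l2_norm_nonneg [simp]: "0 \<le> l2_norm E f"
  by (simp add: l2_norm_def infsum_nonneg)

lemma l2_add:
  assumes "f \<in> l2 E" and "g \<in> l2 E"
  shows "(\<lambda>x. f x + g x) \<in> l2 E" and "l2_norm E (\<lambda>x. f x + g x) \<le> l2_norm E f + l2_norm E g"
proof -
  have bound: "L2_set (\<lambda>x. cmod (f x + g x)) S \<le> l2_norm E f + l2_norm E g"
    if "finite S" "S \<subseteq> E" for S
  proof -
    have "L2_set (\<lambda>x. cmod (f x + g x)) S \<le> L2_set (\<lambda>x. cmod (f x) + cmod (g x)) S"
      by (intro L2_set_mono norm_triangle_ineq) simp
    also have "\<dots> \<le> L2_set (\<lambda>x. cmod (f x)) S + L2_set (\<lambda>x. cmod (g x)) S"
      by (rule L2_set_triangle_ineq)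
    also have "\<dots> \<le> l2_norm E f + l2_norm E g"
      by (intro add_mono L2_set_le_l2_norm assms that)
    finally show ?thesis .
  qed
  have zero: "f x + g x = 0" if "x \<notin> E" for x
    using assms that by (auto simp: l2_def)
  show "(\<lambda>x. f x + g x) \<in> l2 E"
    by (rule l2_memI_bounded(1)[OF zero bound])
  show "l2_norm E (\<lambda>x. f x + g x) \<le> l2_norm E f + l2_norm E g"
    by (rule l2_memI_bounded(2)[OF zero bound])
qed

lemma l2_scale:
  assumes "f \<in> l2 E"
  shows "(\<lambda>x. c * f x) \<in> l2 E"
  using assms by (auto simp: l2_def norm_mult power_mult_distrib intro: summable_on_cmult_right)

lemma l2_diff:
  assumes "f \<in> l2 E" and "g \<in> l2 E"
  shows "(\<lambda>x. f x - g x) \<in> l2 E"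
  using l2_add(1)[OF assms(1) l2_scale[OF assms(2), of "-1"]] by simp

lemma l2_finite_support:
  assumes "finite S" and "S \<subseteq> E" and "\<And>x. x \<notin> S \<Longrightarrow> f x = 0"
  shows "f \<in> l2 E"
proof -
  have "(\<lambda>x. (cmod (f x))\<^sup>2) summable_on S"
    using assms(1) by simp
  then have "(\<lambda>x. (cmod (f x))\<^sup>2) summable_on E"
    by (subst summable_on_cong_neutral[where T = S]) (use assms in auto)
  then show ?thesis
    using assms by (auto simp: l2_def)
qed

lemma basis_fun_l2: "x \<in> E \<Longrightarrow> basis_fun x \<in> l2 E"
  by (rule l2_finite_support[of "{x}"]) (auto simp: basis_fun_def)

lemma coord_proj_l2:
  assumes "f \<in> l2 E"
  shows "coord_proj \<Lambda> f \<in> l2 E"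
proof (rule l2_memI_bounded(1))
  fix S assume S: "finite S" "S \<subseteq> E"
  have "L2_set (\<lambda>x. cmod (coord_proj \<Lambda> f x)) S \<le> L2_set (\<lambda>x. cmod (f x)) S"
    by (rule L2_set_mono) (auto simp: coord_proj_def)
  also have "\<dots> \<le> l2_norm E f"
    by (rule L2_set_le_l2_norm[OF assms S])
  finally show "L2_set (\<lambda>x. cmod (coord_proj \<Lambda> f x)) S \<le> l2_norm E f" .
qed (use assms in \<open>auto simp: l2_def coord_proj_def\<close>)

lemma norm_component_le_l2_norm:
  assumes "f \<in> l2 E"
  shows "cmod (f x) \<le> l2_norm E f"
proof (cases "x \<in> E")
  case True
  then show ?thesis
    using L2_set_le_l2_norm[OF assms, of "{x}"] by simp
qed (use assms in \<open>simp add: l2_def\<close>)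

lemma l2_inner_summable:
  assumes "f \<in> l2 E" and "g \<in> l2 E"
  shows "(\<lambda>x. cnj (f x) * g x) summable_on E"
proof (rule abs_summable_summable)
  have "(\<lambda>x. (cmod (f x))\<^sup>2 + (cmod (g x))\<^sup>2) summable_on E"
    using assms by (intro summable_on_add) (auto simp: l2_def)
  then show "(\<lambda>x. norm (cnj (f x) * g x)) summable_on E"
  proof (rule summable_on_comparison_test)
    fix x assume "x \<in> E"
    have "cmod (f x) * cmod (g x) \<le> (cmod (f x))\<^sup>2 + (cmod (g x))\<^sup>2"
    proof -
      have "0 \<le> cmod (f x) * cmod (g x)"
        by simp
      then show ?thesis
        using sum_squares_bound[of "cmod (f x)" "cmod (g x)"] by linarith
    qed
    then show "norm (cnj (f x) * g x) \<le> (cmod (f x))\<^sup>2 + (cmod (g x))\<^sup>2"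
      by (simp add: norm_mult)
  qed simp
qed

lemma l2_inner_add_right:
  assumes "f \<in> l2 E" and "g \<in> l2 E" and "h \<in> l2 E"
  shows "l2_inner E f (\<lambda>x. g x + h x) = l2_inner E f g + l2_inner E f h"
  using infsum_add[OF l2_inner_summable[OF assms(1,2)] l2_inner_summable[OF assms(1,3)]]
  by (simp add: l2_inner_def algebra_simps)

lemma l2_inner_scale_right: "l2_inner E f (\<lambda>x. c * g x) = c * l2_inner E f g"
  using infsum_cmult_right'[of c "\<lambda>x. cnj (f x) * g x" E] by (simp add: l2_inner_def algebra_simps)

lemma l2_inner_cnj: "l2_inner E g f = cnj (l2_inner E f g)"
  using infsum_cnj[of "\<lambda>x. cnj (f x) * g x" E] by (simp add: l2_inner_def mult.commute)

lemma l2_inner_add_left: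
  assumes "f \<in> l2 E" and "g \<in> l2 E" and "h \<in> l2 E"
  shows "l2_inner E (\<lambda>x. f x + g x) h = l2_inner E f h + l2_inner E g h"
  using l2_inner_add_right[of h E f g] assms l2_inner_cnj[of E _ h] by (metis complex_cnj_add)

lemma l2_inner_scale_left: "l2_inner E (\<lambda>x. c * f x) g = cnj c * l2_inner E f g"
  using l2_inner_scale_right[of E g c f] l2_inner_cnj[of E _ g] by (metis complex_cnj_mult complex_cnj_cnj)

lemma l2_inner_diff_right:
  assumes "f \<in> l2 E" and "g \<in> l2 E" and "h \<in> l2 E"
  shows "l2_inner E f (\<lambda>x. g x - h x) = l2_inner E f g - l2_inner E f h"
  using l2_inner_add_right[OF assms(1,2) l2_scale[OF assms(3), of "-1"]]
    l2_inner_scale_right[of E f "-1" h] by simp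

lemma l2_inner_diff_left:
  assumes "f \<in> l2 E" and "g \<in> l2 E" and "h \<in> l2 E"
  shows "l2_inner E (\<lambda>x. f x - g x) h = l2_inner E f h - l2_inner E g h"
  using l2_inner_add_left[OF assms(1) l2_scale[OF assms(2), of "-1"] assms(3)]
    l2_inner_scale_left[of E "-1" g h] by simp

lemma l2_inner_finite_support:
  assumes "finite S" and "S \<subseteq> E" and "\<And>x. x \<in> E \<Longrightarrow> x \<notin> S \<Longrightarrow> f x = 0 \<or> g x = 0"
  shows "l2_inner E f g = (\<Sum>x\<in>S. cnj (f x) * g x)"
proof -
  have "l2_inner E f g = (\<Sum>\<^sub>\<infinity>x\<in>S. cnj (f x) * g x)"
    unfolding l2_inner_def by (rule infsum_cong_neutral) (use assms in auto)
  then show ?thesis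
    using assms(1) by simp
qed

lemma l2_inner_basis_fun: "x \<in> E \<Longrightarrow> l2_inner E (basis_fun x) f = f x"
  by (subst l2_inner_finite_support[of "{x}"]) (auto simp: basis_fun_def)

lemma l2_inner_self:
  assumes "f \<in> l2 E"
  shows "l2_inner E f f = complex_of_real ((l2_norm E f)\<^sup>2)"
proof -
  have "((\<lambda>x. (cmod (f x))\<^sup>2) has_sum (\<Sum>\<^sub>\<infinity>x\<in>E. (cmod (f x))\<^sup>2)) E"
    using assms by (simp add: l2_def)
  then have "((\<lambda>x. complex_of_real ((cmod (f x))\<^sup>2)) has_sum
      complex_of_real (\<Sum>\<^sub>\<infinity>x\<in>E. (cmod (f x))\<^sup>2)) E"
    by (rule has_sum_of_real)
  then have "((\<lambda>x. cnj (f x) * f x) has_sum complex_of_real (\<Sum>\<^sub>\<infinity>x\<in>E. (cmod (f x))\<^sup>2)) E"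
    by (simp only: complex_norm_square mult.commute)
  then show ?thesis
    by (simp add: l2_inner_def l2_norm_def infsumI infsum_nonneg)
qed

text \<open>
  The form in which both Cauchy-Schwarz inequalities are obtained: \<open>a + 2 t b + t\<^sup>2 c\<close> is the value of a
  semidefinite form on \<open>f + t g\<close>. Only real \<open>t\<close> is needed to bound the real part of a product.
\<close>
lemma discriminant_le_zero:
  fixes a b c :: real
  assumes "0 \<le> c" and "\<And>t. 0 \<le> a + 2 * t * b + t\<^sup>2 * c"
  shows "b\<^sup>2 \<le> a * c"
proof (cases "c = 0")
  case True
  have "b = 0"
  proof (rule ccontr)
    assume b: "b \<noteq> 0"
    define t where "t = - (a + 1) / (2 * b)"
    have "2 * t * b = - (a + 1)"
      using b by (simp add: t_def)
    then show False
      using assms(2)[of t] True by simp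
  qed
  with True show ?thesis
    by simp
next
  case False
  with assms(1) have "0 < c"
    by simp
  then show ?thesis
    using assms(2)[of "- b / c"] by (simp add: field_simps power2_eq_square)
qed

lemma l2_norm_add_scaled:
  assumes "f \<in> l2 E" and "g \<in> l2 E"
  shows "(l2_norm E (\<lambda>x. f x + complex_of_real t * g x))\<^sup>2 =
    (l2_norm E f)\<^sup>2 + 2 * t * Re (l2_inner E f g) + t\<^sup>2 * (l2_norm E g)\<^sup>2"
proof -
  let ?h = "\<lambda>x. f x + complex_of_real t * g x"
  have tg: "(\<lambda>x. complex_of_real t * g x) \<in> l2 E"
    by (rule l2_scale[OF assms(2)])
  have "(l2_norm E ?h)\<^sup>2 = Re (l2_inner E ?h ?h)"
    by (simp add: l2_inner_self l2_add(1) assms tg)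
  also have "\<dots> = Re (l2_inner E f f) + t * Re (l2_inner E f g) + t * Re (l2_inner E g f)
      + t * t * Re (l2_inner E g g)"
    by (simp add: l2_inner_add_left l2_inner_add_right l2_inner_scale_left l2_inner_scale_right
        l2_add(1) assms tg algebra_simps)
  also have "Re (l2_inner E g f) = Re (l2_inner E f g)"
    using l2_inner_cnj[of E g f] by simp
  finally show ?thesis
    by (simp add: l2_inner_self assms power2_eq_square)
qed

lemma l2_cauchy_schwarz:
  assumes "f \<in> l2 E" and "g \<in> l2 E"
  shows "\<bar>Re (l2_inner E f g)\<bar> \<le> l2_norm E f * l2_norm E g"
proof -
  have "(Re (l2_inner E f g))\<^sup>2 \<le> (l2_norm E f)\<^sup>2 * (l2_norm E g)\<^sup>2"
  proof (rule discriminant_le_zero)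
    show "0 \<le> (l2_norm E f)\<^sup>2 + 2 * t * Re (l2_inner E f g) + t\<^sup>2 * (l2_norm E g)\<^sup>2" for t
      unfolding l2_norm_add_scaled[OF assms, symmetric] by simp
  qed simp
  then have "\<bar>Re (l2_inner E f g)\<bar>\<^sup>2 \<le> (l2_norm E f * l2_norm E g)\<^sup>2"
    by (simp add: power_mult_distrib)
  then show ?thesis
    by (rule power2_le_imp_le) simp
qed

lemma l2_partial_sum:
  fixes f :: "nat \<Rightarrow> 'a \<Rightarrow> complex"
  assumes "\<And>k. f k \<in> l2 E"
  shows "(\<lambda>x. \<Sum>k<n. f k x) \<in> l2 E \<and> l2_norm E (\<lambda>x. \<Sum>k<n. f k x) \<le> (\<Sum>k<n. l2_norm E (f k))"
proof (induction n)
  case 0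
  then show ?case by (auto simp: l2_def l2_norm_def)
next
  case (Suc n)
  have IH: "(\<lambda>x. \<Sum>k<n. f k x) \<in> l2 E"
    using Suc by simp
  show ?case
    using Suc l2_add[OF IH assms[of n]] by simp
qed

text \<open>
  The completeness of \<open>l2\<close>, for absolutely convergent series: they converge pointwise, and the bound on
  the partial sums passes to the pointwise limit on every finite set.
\<close>
lemma l2_series:
  assumes "\<And>k. f k \<in> l2 E" and "summable (\<lambda>k. l2_norm E (f k))"
  shows "(\<lambda>x. \<Sum>k. f k x) \<in> l2 E"
    and "l2_norm E (\<lambda>x. \<Sum>k. f k x) \<le> (\<Sum>k. l2_norm E (f k))"
proof -
  have summable: "summable (\<lambda>k. f k x)" for x
    by (rule summable_comparison_test'[OF assms(2)])
      (rule norm_component_le_l2_norm[OF assms(1)])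
  have bound: "L2_set (\<lambda>x. cmod (\<Sum>k. f k x)) S \<le> (\<Sum>k. l2_norm E (f k))"
    if "finite S" "S \<subseteq> E" for S
  proof (rule LIMSEQ_le_const2)
    show "(\<lambda>n. L2_set (\<lambda>x. cmod (\<Sum>k<n. f k x)) S) \<longlonglongrightarrow> L2_set (\<lambda>x. cmod (\<Sum>k. f k x)) S"
      unfolding L2_set_def by (intro tendsto_intros summable_LIMSEQ summable)
    show "\<exists>N. \<forall>n\<ge>N. L2_set (\<lambda>x. cmod (\<Sum>k<n. f k x)) S \<le> (\<Sum>k. l2_norm E (f k))"
    proof (intro exI allI impI)
      fix n :: nat
      have "L2_set (\<lambda>x. cmod (\<Sum>k<n. f k x)) S \<le> l2_norm E (\<lambda>x. \<Sum>k<n. f k x)"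
        using l2_partial_sum[of f E n] assms(1) that by (intro L2_set_le_l2_norm) auto
      also have "\<dots> \<le> (\<Sum>k<n. l2_norm E (f k))"
        using l2_partial_sum[of f E n] assms(1) by simp
      also have "\<dots> \<le> (\<Sum>k. l2_norm E (f k))"
        by (rule sum_le_suminf[OF assms(2)]) auto
      finally show "L2_set (\<lambda>x. cmod (\<Sum>k<n. f k x)) S \<le> (\<Sum>k. l2_norm E (f k))" .
    qed
  qed
  have zero: "(\<Sum>k. f k x) = 0" if "x \<notin> E" for x
    using assms(1) that by (simp add: l2_def)
  show "(\<lambda>x. \<Sum>k. f k x) \<in> l2 E"
    by (rule l2_memI_bounded(1)[OF zero bound])
  show "l2_norm E (\<lambda>x. \<Sum>k. f k x) \<le> (\<Sum>k. l2_norm E (f k))"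
    by (rule l2_memI_bounded(2)[OF zero bound])
qed

lemma l2_series_remainder:
  assumes "\<And>k. f k \<in> l2 E" and "summable (\<lambda>k. l2_norm E (f k))"
  shows "(\<lambda>n. l2_norm E (\<lambda>x. (\<Sum>k. f k x) - (\<Sum>k<n. f k x))) \<longlonglongrightarrow> 0"
proof -
  have summable: "summable (\<lambda>k. f k x)" for x
    by (rule summable_comparison_test'[OF assms(2)])
      (rule norm_component_le_l2_norm[OF assms(1)])
  have bound: "l2_norm E (\<lambda>x. (\<Sum>k. f k x) - (\<Sum>k<n. f k x)) \<le> (\<Sum>k. l2_norm E (f (k + n)))" for n
  proof -
    have "(\<lambda>x. (\<Sum>k. f k x) - (\<Sum>k<n. f k x)) = (\<lambda>x. \<Sum>k. f (k + n) x)"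
      using suminf_minus_initial_segment[OF summable] by (simp add: fun_eq_iff)
    then show ?thesis
      using l2_series(2)[of "\<lambda>k. f (k + n)" E] assms summable_iff_shift[of "\<lambda>k. l2_norm E (f k)" n]
      by simp
  qed
  have "(\<lambda>n. \<Sum>k. l2_norm E (f (k + n))) \<longlonglongrightarrow> 0"
    using suminf_exist_split2[OF assms(2)] .
  then show ?thesis
    by (rule tendsto_sandwich[OF _ _ tendsto_const, rotated 2]) (auto simp: bound)
qed

lemma l2_tail_tendsto_zero:
  assumes "f \<in> l2 E"
  shows "((\<lambda>\<Lambda>. l2_norm E (coord_proj (E - \<Lambda>) f)) \<longlongrightarrow> 0) (finite_subsets_at_top E)"
proof -
  let ?s = "\<Sum>\<^sub>\<infinity>x\<in>E. (cmod (f x))\<^sup>2"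
  have summable: "(\<lambda>x. (cmod (f x))\<^sup>2) summable_on E"
    using assms by (simp add: l2_def)
  have "((\<lambda>\<Lambda>. \<Sum>x\<in>\<Lambda>. (cmod (f x))\<^sup>2) \<longlongrightarrow> ?s) (finite_subsets_at_top E)"
    using summable by (simp add: infsum_tendsto)
  then have lim: "((\<lambda>\<Lambda>. sqrt (?s - (\<Sum>x\<in>\<Lambda>. (cmod (f x))\<^sup>2))) \<longlongrightarrow> sqrt (?s - ?s)) (finite_subsets_at_top E)"
    by (intro tendsto_intros)
  have eq: "l2_norm E (coord_proj (E - \<Lambda>) f) = sqrt (?s - (\<Sum>x\<in>\<Lambda>. (cmod (f x))\<^sup>2))"
    if "finite \<Lambda>" "\<Lambda> \<subseteq> E" for \<Lambda>
  proof -
    have "(\<Sum>\<^sub>\<infinity>x\<in>E. (cmod (coord_proj (E - \<Lambda>) f x))\<^sup>2) = (\<Sum>\<^sub>\<infinity>x\<in>E - \<Lambda>. (cmod (f x))\<^sup>2)"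
      by (rule infsum_cong_neutral) (auto simp: coord_proj_def)
    also have "\<dots> = ?s - (\<Sum>\<^sub>\<infinity>x\<in>\<Lambda>. (cmod (f x))\<^sup>2)"
      by (rule infsum_Diff[OF summable]) (use that in auto)
    finally show ?thesis
      using that(1) by (simp add: l2_norm_def)
  qed
  have "((\<lambda>\<Lambda>. l2_norm E (coord_proj (E - \<Lambda>) f)) \<longlongrightarrow> sqrt (?s - ?s)) (finite_subsets_at_top E)"
    by (rule Lim_transform_eventually[OF lim eventually_finite_subsets_at_top_weakI])
      (simp add: eq)
  then show ?thesis
    by simp
qed

section \<open>Positive operators and the energy form\<close>

locale positive_operator =
  fixes E :: "'a set" and A :: "('a \<Rightarrow> complex) \<Rightarrow> ('a \<Rightarrow> complex)"
  assumes bounded: "bounded_op E A"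
    and hermitian: "hermitian_op E A"
    and positive: "positive_op E A"
begin

lemma op_l2 [simp]: "f \<in> l2 E \<Longrightarrow> A f \<in> l2 E"
  using bounded by (simp add: bounded_op_def)

lemma op_add: "f \<in> l2 E \<Longrightarrow> g \<in> l2 E \<Longrightarrow> A (\<lambda>x. f x + g x) = (\<lambda>x. A f x + A g x)"
  using bounded by (simp add: bounded_op_def)

lemma op_scale: "f \<in> l2 E \<Longrightarrow> A (\<lambda>x. c * f x) = (\<lambda>x. c * A f x)"
  using bounded by (simp add: bounded_op_def)

lemma op_diff: "f \<in> l2 E \<Longrightarrow> g \<in> l2 E \<Longrightarrow> A (\<lambda>x. f x - g x) = (\<lambda>x. A f x - A g x)"
  using op_add[of f "\<lambda>x. -1 * g x"] op_scale[of g "-1"] l2_scale[of g E "-1"] by simp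

lemma op_norm_bound:
  obtains C where "0 \<le> C" and "\<And>f. f \<in> l2 E \<Longrightarrow> l2_norm E (A f) \<le> C * l2_norm E f"
proof -
  obtain C where C: "\<forall>f\<in>l2 E. l2_norm E (A f) \<le> C * l2_norm E f"
    using bounded by (auto simp: bounded_op_def)
  have "l2_norm E (A f) \<le> max 0 C * l2_norm E f" if "f \<in> l2 E" for f
  proof -
    have "C * l2_norm E f \<le> max 0 C * l2_norm E f"
      by (intro mult_right_mono) auto
    with C that show ?thesis
      by fastforce
  qed
  then show thesis
    by (intro that[of "max 0 C"]) auto
qed

text \<open>
  Only the real part of \<open>(f, A g)\<^sub>0\<close> is recorded: it is a symmetric semidefinite bilinear form over the
  reals whose quadratic form is still \<open>\<parallel>f\<parallel>\<^sub>-\<^sup>2\<close>.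
\<close>
definition energy :: "('a \<Rightarrow> complex) \<Rightarrow> ('a \<Rightarrow> complex) \<Rightarrow> real" where
  "energy f g = Re (l2_inner E f (A g))"

lemma energy_nonneg: "f \<in> l2 E \<Longrightarrow> 0 \<le> energy f f"
  using positive by (auto simp: positive_op_def energy_def complex_nonneg_Reals_iff)

lemma minus_norm_power2: "f \<in> l2 E \<Longrightarrow> (minus_norm E A f)\<^sup>2 = energy f f"
  using energy_nonneg by (simp add: minus_norm_def energy_def)

lemma energy_commute:
  assumes "f \<in> l2 E" and "g \<in> l2 E"
  shows "energy f g = energy g f"
  using hermitian assms l2_inner_cnj[of E "A f" g] by (simp add: hermitian_op_def energy_def)

lemma energy_add_left:
  "f \<in> l2 E \<Longrightarrow> g \<in> l2 E \<Longrightarrow> h \<in> l2 E \<Longrightarrow> energy (\<lambda>x. f x + g x) h = energy f h + energy g h"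
  by (simp add: energy_def l2_inner_add_left)

lemma energy_add_right:
  "f \<in> l2 E \<Longrightarrow> g \<in> l2 E \<Longrightarrow> h \<in> l2 E \<Longrightarrow> energy f (\<lambda>x. g x + h x) = energy f g + energy f h"
  by (simp add: energy_def op_add l2_inner_add_right)

lemma energy_diff_right:
  "f \<in> l2 E \<Longrightarrow> g \<in> l2 E \<Longrightarrow> h \<in> l2 E \<Longrightarrow> energy f (\<lambda>x. g x - h x) = energy f g - energy f h"
  by (simp add: energy_def op_diff l2_inner_diff_right)

lemma energy_add_scaled:
  assumes "f \<in> l2 E" and "g \<in> l2 E"
  shows "energy (\<lambda>x. f x + complex_of_real t * g x) (\<lambda>x. f x + complex_of_real t * g x) =
    energy f f + 2 * t * energy f g + t\<^sup>2 * energy g g"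
proof -
  have tg: "(\<lambda>x. complex_of_real t * g x) \<in> l2 E"
    by (rule l2_scale[OF assms(2)])
  have "energy (\<lambda>x. complex_of_real t * g x) h = t * energy g h" for h
    by (simp add: energy_def l2_inner_scale_left)
  moreover have "energy h (\<lambda>x. complex_of_real t * g x) = t * energy h g" for h
    by (simp add: energy_def op_scale assms l2_inner_scale_right)
  ultimately show ?thesis
    using energy_commute[OF assms] assms tg
    by (simp add: energy_add_left energy_add_right l2_add(1) power2_eq_square algebra_simps)
qed

lemma energy_cauchy_schwarz:
  assumes "f \<in> l2 E" and "g \<in> l2 E"
  shows "(energy f g)\<^sup>2 \<le> energy f f * energy g g"
proof (rule discriminant_le_zero)
  show "0 \<le> energy g g"
    by (rule energy_nonneg[OF assms(2)])
next
  fix t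
  have "0 \<le> energy (\<lambda>x. f x + complex_of_real t * g x) (\<lambda>x. f x + complex_of_real t * g x)"
    by (intro energy_nonneg l2_add(1) l2_scale assms)
  then show "0 \<le> energy f f + 2 * t * energy f g + t\<^sup>2 * energy g g"
    by (simp only: energy_add_scaled[OF assms])
qed

text \<open>
  By Cauchy-Schwarz a vector of energy zero is orthogonal in energy to everything, in particular to \<open>A f\<close>,
  and the energy product of \<open>A f\<close> with \<open>f\<close> is \<open>\<parallel>A f\<parallel>\<^sub>0\<^sup>2\<close>.
\<close>
lemma energy_eq_zero_imp_op_eq_zero:
  assumes "f \<in> l2 E" and "energy f f = 0"
  shows "A f = (\<lambda>_. 0)"
proof -
  have "energy (A f) f = 0"
    using energy_cauchy_schwarz[OF op_l2[OF assms(1)] assms(1)] assms(2) by simp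
  then have "l2_norm E (A f) = 0"
    by (simp add: energy_def l2_inner_self assms(1))
  then show ?thesis
    using norm_component_le_l2_norm[of "A f" E] assms(1) by fastforce
qed

definition shifted :: "('a \<Rightarrow> complex) \<Rightarrow> ('a \<Rightarrow> complex)" where
  "shifted f = (\<lambda>x. f x + A f x)"

lemma shifted_l2: "f \<in> l2 E \<Longrightarrow> shifted f \<in> l2 E"
  by (simp add: shifted_def l2_add(1))

lemma shifted_coercive: "f \<in> l2 E \<Longrightarrow> (l2_norm E f)\<^sup>2 \<le> Re (l2_inner E f (shifted f))"
  using energy_nonneg[of f] by (simp add: shifted_def l2_inner_add_right l2_inner_self energy_def)

lemma shifted_inj: "inj_on shifted (l2 E)"
proof (rule inj_onI)
  fix f g assume fg: "f \<in> l2 E" "g \<in> l2 E" "shifted f = shifted g"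
  define d where "d x = f x - g x" for x
  have d: "d \<in> l2 E"
    unfolding d_def by (rule l2_diff[OF fg(1,2)])
  have "shifted d = (\<lambda>x. shifted f x - shifted g x)"
    unfolding shifted_def d_def by (simp add: op_diff fg(1,2) algebra_simps)
  then have "shifted d = (\<lambda>_. 0)"
    using fg(3) by simp
  then have "l2_norm E d = 0"
    using shifted_coercive[OF d] by (simp add: l2_inner_def)
  then show "f = g"
    using norm_component_le_l2_norm[OF d] by (fastforce simp: d_def)
qed

text \<open>
  With \<open>S = I + A\<close>, the square \<open>\<parallel>f - t S f\<parallel>\<^sup>2 = \<parallel>f\<parallel>\<^sup>2 - 2 t (f, S f) + t\<^sup>2 \<parallel>S f\<parallel>\<^sup>2\<close> is at most
  \<open>(1 - 2 t + t\<^sup>2 (1 + C)\<^sup>2) \<parallel>f\<parallel>\<^sup>2\<close>; the chosen \<open>t\<close> minimizes this factor.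
\<close>
lemma shifted_relaxation_contracts:
  assumes "0 \<le> C" and "\<And>f. f \<in> l2 E \<Longrightarrow> l2_norm E (A f) \<le> C * l2_norm E f"
    and "t = 1 / (1 + C)\<^sup>2" and "f \<in> l2 E"
  shows "l2_norm E (\<lambda>x. f x + complex_of_real (- t) * shifted f x) \<le> sqrt (1 - t) * l2_norm E f"
proof -
  have t: "0 < t" "t * (1 + C)\<^sup>2 = 1"
    using assms(1,3) by simp_all
  have "l2_norm E (shifted f) \<le> l2_norm E f + l2_norm E (A f)"
    unfolding shifted_def by (rule l2_add(2)) (use assms(4) in auto)
  also have "\<dots> \<le> (1 + C) * l2_norm E f"
    using assms(2)[OF assms(4)] by (simp add: algebra_simps)
  finally have shifted_le: "(l2_norm E (shifted f))\<^sup>2 \<le> (1 + C)\<^sup>2 * (l2_norm E f)\<^sup>2"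
    using power_mono[of "l2_norm E (shifted f)" "(1 + C) * l2_norm E f" 2]
    by (simp add: power_mult_distrib)
  have "(l2_norm E (\<lambda>x. f x + complex_of_real (- t) * shifted f x))\<^sup>2 =
      (l2_norm E f)\<^sup>2 - 2 * t * Re (l2_inner E f (shifted f)) + t\<^sup>2 * (l2_norm E (shifted f))\<^sup>2"
    by (subst l2_norm_add_scaled) (use assms(4) shifted_l2 in auto)
  also have "\<dots> \<le> (l2_norm E f)\<^sup>2 - 2 * t * (l2_norm E f)\<^sup>2 + t\<^sup>2 * ((1 + C)\<^sup>2 * (l2_norm E f)\<^sup>2)"
    using shifted_coercive[OF assms(4)] shifted_le t(1)
    by (intro add_mono diff_mono mult_left_mono) auto
  also have "t\<^sup>2 * ((1 + C)\<^sup>2 * (l2_norm E f)\<^sup>2) = t * (t * (1 + C)\<^sup>2) * (l2_norm E f)\<^sup>2"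
    by (simp add: power2_eq_square algebra_simps)
  also have "(l2_norm E f)\<^sup>2 - 2 * t * (l2_norm E f)\<^sup>2 + t * (t * (1 + C)\<^sup>2) * (l2_norm E f)\<^sup>2 =
      (1 - t) * (l2_norm E f)\<^sup>2"
    unfolding t(2) by (simp add: algebra_simps)
  finally have "sqrt ((l2_norm E (\<lambda>x. f x + complex_of_real (- t) * shifted f x))\<^sup>2) \<le>
      sqrt ((1 - t) * (l2_norm E f)\<^sup>2)"
    by (rule real_sqrt_le_mono)
  then show ?thesis
    by (simp add: real_sqrt_mult)
qed

text \<open>
  The Neumann series for \<open>(I + A)\<inverse>\<close>: the residuals \<open>r n = (I - t (I + A))\<^sup>n f\<close> decay geometrically, and
  \<open>t\<close> times the sum of all of them solves the equation, because the partial sums telescope.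
\<close>
lemma shifted_surj:
  assumes "f \<in> l2 E"
  obtains u where "u \<in> l2 E" and "shifted u = f"
proof -
  obtain C where C: "0 \<le> C" "\<And>f. f \<in> l2 E \<Longrightarrow> l2_norm E (A f) \<le> C * l2_norm E f"
    using op_norm_bound by blast
  define t where "t = 1 / (1 + C)\<^sup>2"
  define q where "q = sqrt (1 - t)"
  have "1 \<le> (1 + C)\<^sup>2"
    using C(1) by (simp add: one_le_power)
  then have t: "0 < t" "t \<le> 1"
    using C(1) by (simp_all add: t_def divide_le_eq)
  then have q: "0 \<le> q" "q < 1"
    by (simp_all add: q_def)
  define r where "r = (\<lambda>n. ((\<lambda>g x. g x + complex_of_real (- t) * shifted g x) ^^ n) f)"
  have r_Suc: "r (Suc n) = (\<lambda>x. r n x + complex_of_real (- t) * shifted (r n) x)" for n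
    by (simp add: r_def)
  have r_l2: "r n \<in> l2 E" for n
  proof (induction n)
    case 0
    then show ?case using assms by (simp add: r_def)
  next
    case (Suc n)
    then show ?case
      unfolding r_Suc by (intro l2_add(1) l2_scale shifted_l2)
  qed
  have r_norm: "l2_norm E (r n) \<le> q ^ n * l2_norm E f" for n
  proof (induction n)
    case 0
    then show ?case by (simp add: r_def)
  next
    case (Suc n)
    have "l2_norm E (r (Suc n)) \<le> q * l2_norm E (r n)"
      unfolding r_Suc q_def by (rule shifted_relaxation_contracts[OF C t_def r_l2])
    also have "\<dots> \<le> q * (q ^ n * l2_norm E f)"
      by (intro mult_left_mono Suc q)
    finally show ?case by simp
  qed
  have geometric: "summable (\<lambda>n. q ^ n * l2_norm E f)"
    using q by (intro summable_mult2 summable_geometric) simp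
  have summable: "summable (\<lambda>n. l2_norm E (r n))"
    by (rule summable_comparison_test'[OF geometric]) (use r_norm in simp)
  define S where "S x = (\<Sum>k. r k x)" for x
  define P where "P n x = (\<Sum>k<n. r k x)" for n x
  have S_l2: "S \<in> l2 E" and P_l2: "P n \<in> l2 E" for n
    using l2_series(1)[OF r_l2 summable] l2_partial_sum[of r E n] r_l2
    by (simp_all add: S_def[abs_def] P_def[abs_def])
  have telescope: "complex_of_real t * shifted (P n) x = f x - r n x" for n x
  proof (induction n arbitrary: x)
    case 0
    have "A (\<lambda>x. 0) = (\<lambda>x. 0)"
      using op_scale[OF assms, of 0] by simp
    then show ?case
      by (simp add: P_def[abs_def] shifted_def r_def)
  next
    case (Suc n)
    have "P (Suc n) = (\<lambda>x. P n x + r n x)"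
      by (simp add: P_def[abs_def])
    then have "shifted (P (Suc n)) x = shifted (P n) x + shifted (r n) x"
      by (simp add: shifted_def op_add P_l2 r_l2)
    then show ?case
      using Suc[of x] r_Suc[of n] by (simp add: algebra_simps)
  qed
  have "complex_of_real t * shifted S x = f x" for x
  proof -
    have err: "cmod (complex_of_real t * shifted S x - f x) \<le>
        t * ((1 + C) * l2_norm E (\<lambda>x. S x - P n x)) + l2_norm E (r n)" for n
    proof -
      let ?D = "\<lambda>x. S x - P n x"
      have D: "?D \<in> l2 E"
        by (rule l2_diff[OF S_l2 P_l2])
      have "complex_of_real t * shifted S x - f x = complex_of_real t * shifted ?D x - r n x"
        using telescope[of n x] by (simp add: shifted_def op_diff S_l2 P_l2 algebra_simps)
      also have "cmod \<dots> \<le> cmod (complex_of_real t * shifted ?D x) + cmod (r n x)"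
        by (rule norm_triangle_ineq4)
      also have "\<dots> \<le> t * l2_norm E (shifted ?D) + l2_norm E (r n)"
        using t(1) norm_component_le_l2_norm[OF shifted_l2[OF D], of x]
          norm_component_le_l2_norm[OF r_l2, of n x] by (auto simp: norm_mult intro!: add_mono)
      also have "l2_norm E (shifted ?D) \<le> (1 + C) * l2_norm E ?D"
        using l2_add(2)[OF D op_l2[OF D]] C(2)[OF D] by (simp add: shifted_def algebra_simps)
      finally show ?thesis
        using t(1) by simp
    qed
    have "(\<lambda>n. l2_norm E (\<lambda>x. S x - P n x)) \<longlonglongrightarrow> 0"
      unfolding S_def P_def by (rule l2_series_remainder[OF r_l2 summable])
    moreover have "(\<lambda>n. l2_norm E (r n)) \<longlonglongrightarrow> 0"
      by (rule summable_LIMSEQ_zero[OF summable])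
    ultimately have "(\<lambda>n. t * ((1 + C) * l2_norm E (\<lambda>x. S x - P n x)) + l2_norm E (r n)) \<longlonglongrightarrow>
        t * ((1 + C) * 0) + 0"
      by (intro tendsto_intros)
    then have "cmod (complex_of_real t * shifted S x - f x) \<le> t * ((1 + C) * 0) + 0"
      by (rule LIMSEQ_le_const) (use err in auto)
    then show ?thesis
      by simp
  qed
  then have "shifted (\<lambda>x. complex_of_real t * S x) = f"
    by (simp add: shifted_def op_scale S_l2 algebra_simps)
  then show thesis
    by (rule that[OF l2_scale[OF S_l2]])
qed

end

section \<open>The resolvent and its finite sections\<close>

context positive_operator
begin

definition resolvent :: "('a \<Rightarrow> complex) \<Rightarrow> ('a \<Rightarrow> complex)" where
  "resolvent = inv_into (l2 E) shifted"

lemma resolvent_l2: "f \<in> l2 E \<Longrightarrow> resolvent f \<in> l2 E"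
  and shifted_resolvent: "f \<in> l2 E \<Longrightarrow> shifted (resolvent f) = f"
proof -
  assume "f \<in> l2 E"
  then have "f \<in> shifted ` l2 E"
    using shifted_surj by blast
  then show "resolvent f \<in> l2 E" "shifted (resolvent f) = f"
    unfolding resolvent_def by (rule inv_into_into, rule f_inv_into_f)
qed

lemma resolvent_shifted: "u \<in> l2 E \<Longrightarrow> resolvent (shifted u) = u"
  unfolding resolvent_def by (rule inv_into_f_f[OF shifted_inj])

lemma kernel_of_eq:
  assumes "f \<in> l2 E"
  shows "kernel_of E A f = (\<lambda>x. f x - resolvent f x)"
proof -
  have "kernel_of E A f = A (resolvent f)"
    by (simp add: kernel_of_def resolvent_def shifted_def[abs_def])
  moreover have "A (resolvent f) x = f x - resolvent f x" for x
    using fun_cong[OF shifted_resolvent[OF assms], of x] by (simp add: shifted_def algebra_simps)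
  ultimately show ?thesis
    by auto
qed

lemma resolvent_add_scaled:
  assumes "f \<in> l2 E" and "g \<in> l2 E"
  shows "resolvent (\<lambda>x. f x + c * g x) = (\<lambda>x. resolvent f x + c * resolvent g x)"
proof -
  let ?u = "\<lambda>x. resolvent f x + c * resolvent g x"
  have u: "?u \<in> l2 E"
    by (intro l2_add(1) l2_scale resolvent_l2 assms)
  have "shifted ?u = (\<lambda>x. shifted (resolvent f) x + c * shifted (resolvent g) x)"
    unfolding shifted_def
    by (simp add: op_add op_scale l2_scale resolvent_l2 assms algebra_simps)
  then show ?thesis
    using resolvent_shifted[OF u] by (simp add: shifted_resolvent assms)
qed

text \<open>
  The matrix of \<open>(I + A)\<inverse> = I - K\<close>; its restriction to \<open>\<Lambda>\<close> is the matrix of \<open>I\<^sub>\<Lambda> - K\<^sub>\<Lambda>\<close>.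
\<close>
definition resolvent_entry :: "'a \<Rightarrow> 'a \<Rightarrow> complex" where
  "resolvent_entry x y = resolvent (basis_fun y) x"

lemma resolvent_finite_support:
  assumes "finite \<Lambda>" and "\<Lambda> \<subseteq> E" and "\<And>x. x \<notin> \<Lambda> \<Longrightarrow> v x = 0"
  shows "resolvent v x = (\<Sum>y\<in>\<Lambda>. resolvent_entry x y * v y)"
  using assms
proof (induction \<Lambda> arbitrary: v rule: finite_induct)
  case empty
  have zero: "(\<lambda>_. 0) \<in> l2 E"
    by (rule l2_finite_support[of "{}"]) auto
  have "shifted (\<lambda>_. 0) = (\<lambda>_. 0)"
    using op_scale[OF zero, of 0] by (simp add: shifted_def)
  with resolvent_shifted[OF zero] empty show ?case
    by (simp add: fun_eq_iff[symmetric] ext[of v "\<lambda>_. 0"])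
next
  case (insert a \<Lambda>)
  let ?w = "\<lambda>x. if x = a then 0 else v x"
  have w: "?w \<in> l2 E"
    by (rule l2_finite_support[of \<Lambda>]) (use insert in auto)
  have "v = (\<lambda>x. ?w x + v a * basis_fun a x)"
    by (auto simp: basis_fun_def)
  then have "resolvent v = resolvent (\<lambda>x. ?w x + v a * basis_fun a x)"
    by (rule arg_cong)
  also have "\<dots> = (\<lambda>x. resolvent ?w x + v a * resolvent (basis_fun a) x)"
    by (rule resolvent_add_scaled[OF w basis_fun_l2]) (use insert.prems in auto)
  finally have "resolvent v x = resolvent ?w x + v a * resolvent_entry x a"
    by (simp add: resolvent_entry_def)
  also have "resolvent ?w x = (\<Sum>y\<in>\<Lambda>. resolvent_entry x y * ?w y)"
    by (rule insert.IH) (use insert in auto)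
  also have "\<dots> = (\<Sum>y\<in>\<Lambda>. resolvent_entry x y * v y)"
    by (rule sum.cong) (use insert.hyps in auto)
  finally show ?case
    using insert.hyps by (simp add: algebra_simps)
qed

lemma op_entry_kernel_of:
  assumes "x \<in> E" and "y \<in> E"
  shows "op_entry E (kernel_of E A) x y = of_bool (x = y) - resolvent_entry x y"
proof -
  have "op_entry E (kernel_of E A) x y = basis_fun y x - resolvent_entry x y"
    using assms by (simp add: op_entry_def l2_inner_basis_fun kernel_of_eq basis_fun_l2 resolvent_entry_def)
  then show ?thesis
    by (simp add: basis_fun_def)
qed

text \<open>
  The finite sections of the resolvent are injective: if \<open>u = (I + A)\<inverse> v\<close> vanishes on \<open>\<Lambda>\<close>, which carries
  \<open>v\<close>, then \<open>(u, (I + A) u)\<^sub>0 = (u, v)\<^sub>0 = 0\<close>, and \<open>I + A\<close> is bounded below by \<open>I\<close>.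
\<close>
lemma det_resolvent_nonzero:
  assumes "finite \<Lambda>" and "\<Lambda> \<subseteq> E"
  shows "det_on \<Lambda> resolvent_entry \<noteq> 0"
proof (rule det_on_nonzero_if_injective[OF assms(1)])
  fix v assume v: "\<forall>x. x \<notin> \<Lambda> \<longrightarrow> v x = 0" "\<forall>x\<in>\<Lambda>. (\<Sum>y\<in>\<Lambda>. resolvent_entry x y * v y) = 0"
  have v_l2: "v \<in> l2 E"
    by (rule l2_finite_support[OF assms]) (use v in auto)
  define u where "u = resolvent v"
  have u: "u \<in> l2 E" "shifted u = v"
    by (simp_all add: u_def resolvent_l2 shifted_resolvent v_l2)
  have "u x = 0" if "x \<in> \<Lambda>" for x
    using resolvent_finite_support[OF assms, of v x] v that by (simp add: u_def)
  then have "l2_inner E u (shifted u) = 0"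
    unfolding u(2) by (subst l2_inner_finite_support[OF assms]) (use v in auto)
  then have "l2_norm E u = 0"
    using shifted_coercive[OF u(1)] by simp
  then have "u = (\<lambda>_. 0)"
    using norm_component_le_l2_norm[OF u(1)] by fastforce
  then show "\<forall>x\<in>\<Lambda>. v x = 0"
    using u(2) op_scale[OF v_l2, of 0] by (auto simp: shifted_def)
qed

text \<open>
  The matrix identity \<open>(I\<^sub>\<Lambda> - K\<^sub>\<Lambda>) A\<^sub>[\<^sub>\<Lambda>\<^sub>] = K\<^sub>\<Lambda>\<close>, through which \<open>A\<^sub>[\<^sub>\<Lambda>\<^sub>]\<close> enters everything below.
  The inverse in its definition makes sense because the section of the resolvent is nonsingular.
\<close>
lemma local_entry_eq:
  assumes "finite \<Lambda>" and "\<Lambda> \<subseteq> E" and "x \<in> \<Lambda>" and "y \<in> \<Lambda>"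
  shows "(\<Sum>z\<in>\<Lambda>. resolvent_entry x z * local_entry \<Lambda> (kernel_of E A) z y) =
    of_bool (x = y) - resolvent_entry x y"
proof -
  let ?K = "kernel_of E A"
  define T where "T = (\<lambda>g x. g x - compression \<Lambda> ?K g x)"
  have T_eq: "T g = coord_proj \<Lambda> (resolvent g)" if g: "g \<in> l2 \<Lambda>" for g
  proof -
    have off: "g x = 0" if "x \<notin> \<Lambda>" for x
      using g that by (simp add: l2_def)
    have "g \<in> l2 E"
      by (rule l2_finite_support[OF assms(1,2) off])
    moreover have "coord_proj \<Lambda> g = g"
      using off by (auto simp: coord_proj_def)
    ultimately show ?thesis
      using off by (auto simp: T_def compression_def kernel_of_eq coord_proj_def)
  qed
  obtain g where g: "\<And>x. x \<notin> \<Lambda> \<Longrightarrow> g x = 0"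
      "\<And>x. x \<in> \<Lambda> \<Longrightarrow> (\<Sum>z\<in>\<Lambda>. resolvent_entry x z * g z) = basis_fun y x"
    using solve_linear_system_on[OF assms(1) det_resolvent_nonzero[OF assms(1,2)], of "basis_fun y"]
    by blast
  have g_l2: "g \<in> l2 \<Lambda>"
    by (rule l2_finite_support[OF assms(1) order_refl g(1)])
  have "T g = basis_fun y"
    unfolding T_eq[OF g_l2] using g(2) assms(4) resolvent_finite_support[OF assms(1,2) g(1)]
    by (auto simp: coord_proj_def basis_fun_def)
  then have y_image: "basis_fun y \<in> T ` l2 \<Lambda>"
    using g_l2 by (metis imageI)
  define U where "U = inv_into (l2 \<Lambda>) T (basis_fun y)"
  have U: "U \<in> l2 \<Lambda>" "T U = basis_fun y"
    unfolding U_def using y_image by (rule inv_into_into, rule f_inv_into_f)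
  have U_off: "U z = 0" if "z \<notin> \<Lambda>" for z
    using U(1) that by (simp add: l2_def)
  have "local_op \<Lambda> ?K (basis_fun y) z = U z - basis_fun y z" for z
    using fun_cong[OF U(2), of z] by (simp add: local_op_def T_def U_def algebra_simps)
  then have entry: "local_entry \<Lambda> ?K z y = U z - basis_fun y z" if "z \<in> \<Lambda>" for z
    using that by (simp add: local_entry_def op_entry_def l2_inner_basis_fun)
  have "(\<Sum>z\<in>\<Lambda>. resolvent_entry x z * local_entry \<Lambda> ?K z y) =
      (\<Sum>z\<in>\<Lambda>. resolvent_entry x z * U z) - (\<Sum>z\<in>\<Lambda>. if z = y then resolvent_entry x z else 0)"
    unfolding sum_subtractf[symmetric]
    by (rule sum.cong) (auto simp: entry basis_fun_def algebra_simps)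
  also have "(\<Sum>z\<in>\<Lambda>. resolvent_entry x z * U z) = T U x"
    using assms(3) resolvent_finite_support[OF assms(1,2) U_off]
    by (simp add: T_eq[OF U(1)] coord_proj_def)
  finally show ?thesis
    using assms by (simp add: U(2) basis_fun_def)
qed

end

section \<open>Cylinder probabilities of a determinantal process\<close>

text \<open>
  Fixing one coordinate is an open condition in the product topology, whichever value is prescribed.
\<close>
lemma cylinder_measurable:
  assumes "finite X" and "finite Y" and "X \<subseteq> E" and "Y \<subseteq> E"
  shows "{\<zeta> \<in> Pow E. X \<subseteq> \<zeta> \<and> \<zeta> \<inter> Y = {}} \<in> sets (config_space E)"
proof -
  let ?T = "indicator_topology E" and ?\<phi> = "\<lambda>\<xi>. \<lambda>x\<in>E. x \<in> \<xi>"
  have preimage: "?\<phi> -` U \<inter> Pow E \<in> sets (config_space E)" if "openin ?T U" for U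
    unfolding config_space_def
    by (intro in_vimage_algebra in_measure_of) (use that openin_subset in auto)
  have range: "?\<phi> \<zeta> \<in> topspace ?T" if "\<zeta> \<in> Pow E" for \<zeta>
    by (simp add: indicator_topology_def)
  have "?\<phi> -` topspace ?T \<inter> Pow E = Pow E"
    using range by auto
  then have whole: "Pow E \<in> sets (config_space E)"
    using preimage[OF openin_topspace] by simp
  have single: "{\<zeta> \<in> Pow E. (x \<in> \<zeta>) = b} \<in> sets (config_space E)" if x: "x \<in> E" for x b
  proof -
    have "openin ?T {f \<in> topspace ?T. f x \<in> {b}}"
      unfolding indicator_topology_def
      by (rule openin_continuous_map_preimage[OF continuous_map_product_projection[OF x]]) simp
    then have "?\<phi> -` {f \<in> topspace ?T. f x \<in> {b}} \<inter> Pow E \<in> sets (config_space E)"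
      by (rule preimage)
    moreover have "?\<phi> -` {f \<in> topspace ?T. f x \<in> {b}} \<inter> Pow E = {\<zeta> \<in> Pow E. (x \<in> \<zeta>) = b}"
      using x range by auto
    ultimately show ?thesis
      by simp
  qed
  have contains: "{\<zeta> \<in> Pow E. X \<subseteq> \<zeta>} \<in> sets (config_space E)"
    using assms(1,3)
  proof (induction X)
    case empty
    then show ?case using whole by (simp add: Pow_def)
  next
    case (insert x X)
    have "{\<zeta> \<in> Pow E. insert x X \<subseteq> \<zeta>} = {\<zeta> \<in> Pow E. (x \<in> \<zeta>) = True} \<inter> {\<zeta> \<in> Pow E. X \<subseteq> \<zeta>}"
      by auto
    then show ?case
      using single[of x True] insert by (simp only: insert_subset sets.Int)
  qed
  have avoids: "{\<zeta> \<in> Pow E. \<zeta> \<inter> Y = {}} \<in> sets (config_space E)"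
    using assms(2,4)
  proof (induction Y)
    case empty
    then show ?case using whole by (simp add: Pow_def)
  next
    case (insert y Y)
    have "{\<zeta> \<in> Pow E. \<zeta> \<inter> insert y Y = {}} =
        {\<zeta> \<in> Pow E. (y \<in> \<zeta>) = False} \<inter> {\<zeta> \<in> Pow E. \<zeta> \<inter> Y = {}}"
      by auto
    then show ?case
      using single[of y False] insert by (simp only: insert_subset sets.Int)
  qed
  have "{\<zeta> \<in> Pow E. X \<subseteq> \<zeta> \<and> \<zeta> \<inter> Y = {}} = {\<zeta> \<in> Pow E. X \<subseteq> \<zeta>} \<inter> {\<zeta> \<in> Pow E. \<zeta> \<inter> Y = {}}"
    by auto
  then show ?thesis
    using contains avoids by (simp only: sets.Int)
qed

text \<open>
  Inclusion-exclusion, one excluded point \<open>y\<close> at a time: \<open>\<mu>(y \<notin> \<zeta>, \<dots>) = \<mu>(\<dots>) - \<mu>(y \<in> \<zeta>, \<dots>)\<close> matches the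
  linearity of the determinant in column \<open>y\<close>, the identity column standing for the absence of a condition.
\<close>
lemma determinantal_cylinder:
  assumes "determinantal_process E K \<mu>"
    and "finite Y" and "finite X" and "Y \<subseteq> E" and "X \<subseteq> E" and "X \<inter> Y = {}"
  shows "complex_of_real (measure \<mu> {\<zeta> \<in> Pow E. X \<subseteq> \<zeta> \<and> \<zeta> \<inter> Y = {}}) =
    det_on (X \<union> Y) (\<lambda>x y. if y \<in> X then op_entry E K x y else of_bool (x = y) - op_entry E K x y)"
  using assms(2-)
proof (induction Y arbitrary: X)
  case empty
  have "det_on X (op_entry E K) =
      det_on X (\<lambda>x y. if y \<in> X then op_entry E K x y else of_bool (x = y) - op_entry E K x y)"
    by (rule det_on_cong) simp
  moreover have "complex_of_real (measure \<mu> {\<zeta> \<in> Pow E. X \<subseteq> \<zeta>}) = det_on X (op_entry E K)"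
    using assms(1) empty by (simp add: determinantal_process_def)
  ultimately show ?case
    by simp
next
  case (insert y Y)
  let ?M = "\<lambda>X x y. if y \<in> X then op_entry E K x y else of_bool (x = y) - op_entry E K x y"
  let ?D = "\<lambda>a b. if b = y then of_bool (a = b) else ?M X a b"
  let ?C = "\<lambda>X Y. {\<zeta> \<in> Pow E. X \<subseteq> \<zeta> \<and> \<zeta> \<inter> Y = {}}"
  interpret prob_space \<mu>
    using assms(1) by (simp add: determinantal_process_def)
  have cyl: "?C X' Y' \<in> sets \<mu>" if "finite X'" "finite Y'" "X' \<subseteq> E" "Y' \<subseteq> E" for X' Y'
    using cylinder_measurable[OF that] assms(1) by (simp add: determinantal_process_def)
  have column: "det_on (insert y (X \<union> Y)) ?D = ?D y y * det_on (X \<union> Y) ?D"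
    by (rule det_on_insert_column) (use insert.hyps insert.prems in auto)
  have "?C X Y = ?C X (insert y Y) \<union> ?C (insert y X) Y"
    by auto
  moreover have "measure \<mu> (?C X (insert y Y) \<union> ?C (insert y X) Y) =
      measure \<mu> (?C X (insert y Y)) + measure \<mu> (?C (insert y X) Y)"
  proof (rule finite_measure_Union)
    show "?C X (insert y Y) \<in> sets \<mu>"
      by (rule cyl) (use insert.hyps insert.prems in auto)
    show "?C (insert y X) Y \<in> sets \<mu>"
      by (rule cyl) (use insert.hyps insert.prems in auto)
    show "?C X (insert y Y) \<inter> ?C (insert y X) Y = {}"
      by auto
  qed
  ultimately have "complex_of_real (measure \<mu> (?C X (insert y Y))) =
      complex_of_real (measure \<mu> (?C X Y)) - complex_of_real (measure \<mu> (?C (insert y X) Y))"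
    by simp
  also have "complex_of_real (measure \<mu> (?C X Y)) = det_on (X \<union> Y) (?M X)"
    by (rule insert.IH) (use insert.hyps insert.prems in auto)
  also have "complex_of_real (measure \<mu> (?C (insert y X) Y)) = det_on (insert y X \<union> Y) (?M (insert y X))"
    by (rule insert.IH) (use insert.hyps insert.prems in auto)
  also have "det_on (X \<union> Y) (?M X) = det_on (X \<union> Y) ?D"
    by (rule det_on_cong) (use insert.hyps insert.prems in auto)
  also have "\<dots> = det_on (insert y (X \<union> Y)) ?D"
    using column by simp
  also have "\<dots> = det_on (insert y (X \<union> Y)) (?M X) + det_on (insert y (X \<union> Y)) (?M (insert y X))"
    by (rule det_on_column_add[where a = y]) (use insert.hyps insert.prems in auto)
  finally show ?case
    by simp
qed

context positive_operator
begin

text \<open>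
  By \<open>local_entry_eq\<close> the matrix of \<open>determinantal_cylinder\<close>, with columns of \<open>K\<close> at \<open>X\<close> and of \<open>I - K\<close>
  elsewhere, is \<open>I\<^sub>\<Lambda> - K\<^sub>\<Lambda>\<close> times the matrix with columns of \<open>A\<^sub>[\<^sub>\<Lambda>\<^sub>]\<close> at \<open>X\<close> and of the identity elsewhere.
\<close>
lemma cylinder_prob_eq:
  assumes "determinantal_process E (kernel_of E A) \<mu>"
    and "finite \<Lambda>" and "\<Lambda> \<subseteq> E" and "X \<subseteq> \<Lambda>"
  shows "complex_of_real (cylinder_prob E \<mu> \<Lambda> X) =
    det_on \<Lambda> resolvent_entry * det_on X (local_entry \<Lambda> (kernel_of E A))"
proof -
  let ?B = "local_entry \<Lambda> (kernel_of E A)" and ?K = "op_entry E (kernel_of E A)"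
  let ?J = "\<lambda>z y. if y \<in> X then ?B z y else of_bool (z = y)"
  have X: "finite X" "X \<union> (\<Lambda> - X) = \<Lambda>"
    using assms finite_subset by blast+
  have "{\<zeta> \<in> Pow E. \<zeta> \<inter> \<Lambda> = X} = {\<zeta> \<in> Pow E. X \<subseteq> \<zeta> \<and> \<zeta> \<inter> (\<Lambda> - X) = {}}"
    using assms(4) by auto
  then have "complex_of_real (cylinder_prob E \<mu> \<Lambda> X) =
      det_on \<Lambda> (\<lambda>x y. if y \<in> X then ?K x y else of_bool (x = y) - ?K x y)"
    using determinantal_cylinder[OF assms(1), of "\<Lambda> - X" X] X assms
    by (simp add: cylinder_prob_def) blast
  also have "\<dots> = det_on \<Lambda> (\<lambda>x y. \<Sum>z\<in>\<Lambda>. resolvent_entry x z * ?J z y)"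
  proof (rule det_on_cong)
    fix x y assume xy: "x \<in> \<Lambda>" "y \<in> \<Lambda>"
    then have K: "?K x y = of_bool (x = y) - resolvent_entry x y"
      using assms(3) by (intro op_entry_kernel_of) auto
    show "(if y \<in> X then ?K x y else of_bool (x = y) - ?K x y) = (\<Sum>z\<in>\<Lambda>. resolvent_entry x z * ?J z y)"
    proof (cases "y \<in> X")
      case True
      then show ?thesis
        using local_entry_eq[OF assms(2,3) xy] K by simp
    next
      case False
      then have "(\<Sum>z\<in>\<Lambda>. resolvent_entry x z * ?J z y) = (\<Sum>z\<in>\<Lambda>. if z = y then resolvent_entry x z else 0)"
        by (intro sum.cong) auto
      then show ?thesis
        using False xy assms(2) K by simp
    qed
  qed
  also have "\<dots> = det_on \<Lambda> resolvent_entry * det_on \<Lambda> ?J"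
    by (rule det_on_mult[OF assms(2)])
  also have "det_on \<Lambda> ?J = det_on X ?B"
    using det_on_identity_columns[of "\<Lambda> - X" X ?B] X assms(2) by simp
  finally show ?thesis .
qed

end

section \<open>Equilibrium extensions\<close>

context positive_operator
begin

text \<open>
  The extension is \<open>u = (I + A)\<inverse> w\<close> with \<open>w = v + A\<^sub>[\<^sub>\<Lambda>\<^sub>] v\<close> on \<open>\<Lambda>\<close>: then \<open>u = v\<close> on \<open>\<Lambda>\<close> because
  \<open>I + A\<^sub>[\<^sub>\<Lambda>\<^sub>]\<close> inverts \<open>I\<^sub>\<Lambda> - K\<^sub>\<Lambda>\<close>, and \<open>A u = w - u\<close> is \<open>A\<^sub>[\<^sub>\<Lambda>\<^sub>] v\<close> there.
\<close>
lemma local_extension: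
  assumes "finite \<Lambda>" and "\<Lambda> \<subseteq> E" and "\<And>x. x \<notin> \<Lambda> \<Longrightarrow> v x = 0"
  obtains u where "u \<in> l2 E" and "\<And>x. x \<in> \<Lambda> \<Longrightarrow> u x = v x"
    and "\<And>x. x \<notin> \<Lambda> \<Longrightarrow> shifted u x = 0"
    and "\<And>x. x \<in> \<Lambda> \<Longrightarrow> A u x = (\<Sum>y\<in>\<Lambda>. local_entry \<Lambda> (kernel_of E A) x y * v y)"
proof -
  let ?B = "local_entry \<Lambda> (kernel_of E A)"
  define w where "w x = (if x \<in> \<Lambda> then v x + (\<Sum>y\<in>\<Lambda>. ?B x y * v y) else 0)" for x
  have w_off: "w x = 0" if "x \<notin> \<Lambda>" for x
    using that by (simp add: w_def)
  have w_l2: "w \<in> l2 E"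
    by (rule l2_finite_support[OF assms(1,2) w_off])
  define u where "u = resolvent w"
  have u_l2: "u \<in> l2 E" and u_w: "shifted u = w"
    by (simp_all add: u_def resolvent_l2 shifted_resolvent w_l2)
  have u_v: "u x = v x" if x: "x \<in> \<Lambda>" for x
  proof -
    have "u x = (\<Sum>z\<in>\<Lambda>. resolvent_entry x z * w z)"
      unfolding u_def by (rule resolvent_finite_support[OF assms(1,2) w_off])
    also have "\<dots> = (\<Sum>z\<in>\<Lambda>. resolvent_entry x z * v z) + (\<Sum>z\<in>\<Lambda>. \<Sum>y\<in>\<Lambda>. resolvent_entry x z * (?B z y * v y))"
      by (simp add: w_def algebra_simps sum_distrib_left sum.distrib)
    also have "(\<Sum>z\<in>\<Lambda>. \<Sum>y\<in>\<Lambda>. resolvent_entry x z * (?B z y * v y)) =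
        (\<Sum>y\<in>\<Lambda>. (\<Sum>z\<in>\<Lambda>. resolvent_entry x z * ?B z y) * v y)"
      by (subst sum.swap) (simp add: sum_distrib_right mult.assoc)
    also have "\<dots> = (\<Sum>y\<in>\<Lambda>. (of_bool (x = y) - resolvent_entry x y) * v y)"
      using local_entry_eq[OF assms(1,2) x] by (intro sum.cong) auto
    also have "\<dots> = (\<Sum>y\<in>\<Lambda>. if y = x then v y else 0) - (\<Sum>y\<in>\<Lambda>. resolvent_entry x y * v y)"
      unfolding sum_subtractf[symmetric] by (intro sum.cong) (auto simp: algebra_simps)
    finally show ?thesis
      using assms(1) x by simp
  qed
  show thesis
  proof (rule that[OF u_l2 u_v])
    show "shifted u x = 0" if "x \<notin> \<Lambda>" for x
      using that by (simp add: u_w w_off)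
    show "A u x = (\<Sum>y\<in>\<Lambda>. ?B x y * v y)" if "x \<in> \<Lambda>" for x
      using fun_cong[OF u_w, of x] u_v[OF that] that by (simp add: shifted_def w_def)
  qed
qed

text \<open>
  Off \<open>\<Lambda>\<close> the condition \<open>(I + A) u = 0\<close> says \<open>A u = - u\<close>, so that \<open>A u\<close> splits into a part on \<open>\<Lambda>\<close> and
  the negative of the outer part of \<open>u\<close>.
\<close>
lemma energy_local_extension:
  assumes "finite \<Lambda>" and "\<Lambda> \<subseteq> E" and "g \<in> l2 E" and "u \<in> l2 E"
    and "\<And>x. x \<notin> \<Lambda> \<Longrightarrow> shifted u x = 0"
  shows "energy g u = Re (\<Sum>x\<in>\<Lambda>. cnj (g x) * A u x) - Re (l2_inner E g (coord_proj (E - \<Lambda>) u))"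
proof -
  have "A u = (\<lambda>x. coord_proj \<Lambda> (A u) x - coord_proj (E - \<Lambda>) u x)"
  proof
    fix x
    have "A u x = 0" "u x = 0" if "x \<notin> E"
      using that assms(4) op_l2[OF assms(4)] by (simp_all add: l2_def)
    then show "A u x = coord_proj \<Lambda> (A u) x - coord_proj (E - \<Lambda>) u x"
      using assms(2) assms(5)[of x]
      by (auto simp: coord_proj_def shifted_def add_eq_0_iff)
  qed
  then have "l2_inner E g (A u) = l2_inner E g (\<lambda>x. coord_proj \<Lambda> (A u) x - coord_proj (E - \<Lambda>) u x)"
    by (rule arg_cong)
  also have "\<dots> = l2_inner E g (coord_proj \<Lambda> (A u)) - l2_inner E g (coord_proj (E - \<Lambda>) u)"
    by (intro l2_inner_diff_right coord_proj_l2 op_l2 assms)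
  also have "l2_inner E g (coord_proj \<Lambda> (A u)) = (\<Sum>x\<in>\<Lambda>. cnj (g x) * A u x)"
    by (subst l2_inner_finite_support[OF assms(1,2)]) (auto simp: coord_proj_def)
  finally show ?thesis
    by (simp add: energy_def)
qed

lemma l2_inner_coord_proj_self:
  assumes "u \<in> l2 E"
  shows "l2_inner E u (coord_proj S u) = complex_of_real ((l2_norm E (coord_proj S u))\<^sup>2)"
proof -
  have "l2_inner E u (coord_proj S u) = l2_inner E (coord_proj S u) (coord_proj S u)"
    unfolding l2_inner_def by (rule infsum_cong) (auto simp: coord_proj_def)
  then show ?thesis
    by (simp add: l2_inner_self coord_proj_l2 assms)
qed

end

locale injective_positive_operator = positive_operator +
  assumes kernel_trivial: "ker_op E A = {\<lambda>_. 0}"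
begin

text \<open>
  If \<open>v\<close> is carried by \<open>X\<close> and \<open>A\<^sub>[\<^sub>\<Lambda>\<^sub>] v\<close> vanishes on \<open>X\<close>, the extension \<open>u\<close> of \<open>v\<close> has energy
  \<open>- \<parallel>1\<^sub>E\<^sub>-\<^sub>\<Lambda> u\<parallel>\<^sub>0\<^sup>2 \<le> 0\<close>. Hence \<open>A u = 0\<close>, and \<open>u = 0\<close> since the kernel of \<open>A\<close> is trivial.
\<close>
lemma det_local_entry_nonzero:
  assumes "finite \<Lambda>" and "\<Lambda> \<subseteq> E" and "X \<subseteq> \<Lambda>"
  shows "det_on X (local_entry \<Lambda> (kernel_of E A)) \<noteq> 0"
proof (rule det_on_nonzero_if_injective)
  let ?B = "local_entry \<Lambda> (kernel_of E A)"
  show "finite X"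
    using assms finite_subset by blast
  fix v assume v: "\<forall>x. x \<notin> X \<longrightarrow> v x = 0" "\<forall>x\<in>X. (\<Sum>y\<in>X. ?B x y * v y) = 0"
  obtain u where u: "u \<in> l2 E" "\<And>x. x \<in> \<Lambda> \<Longrightarrow> u x = v x" "\<And>x. x \<notin> \<Lambda> \<Longrightarrow> shifted u x = 0"
      "\<And>x. x \<in> \<Lambda> \<Longrightarrow> A u x = (\<Sum>y\<in>\<Lambda>. ?B x y * v y)"
    using local_extension[OF assms(1,2), of v] v(1) assms(3) by blast
  have "(\<Sum>y\<in>\<Lambda>. ?B x y * v y) = (\<Sum>y\<in>X. ?B x y * v y)" for x
    by (rule sum.mono_neutral_right) (use assms v(1) in auto)
  then have "cnj (u x) * A u x = 0" if "x \<in> \<Lambda>" for x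
    using u(2,4)[OF that] v by (cases "x \<in> X") auto
  then have inside: "(\<Sum>x\<in>\<Lambda>. cnj (u x) * A u x) = 0"
    by (rule sum.neutral[OF ballI])
  have "energy u u =
      Re (\<Sum>x\<in>\<Lambda>. cnj (u x) * A u x) - Re (l2_inner E u (coord_proj (E - \<Lambda>) u))"
    by (rule energy_local_extension[OF assms(1,2) u(1) u(1)]) (rule u(3))
  then have "energy u u = - (l2_norm E (coord_proj (E - \<Lambda>) u))\<^sup>2"
    unfolding inside l2_inner_coord_proj_self[OF u(1)] by simp
  then have "energy u u = 0"
    using energy_nonneg[OF u(1)] by (smt (verit) zero_le_power2)
  then have "u \<in> ker_op E A"
    using energy_eq_zero_imp_op_eq_zero[OF u(1)] u(1) by (simp add: ker_op_def)
  then have "u = (\<lambda>_. 0)"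
    using kernel_trivial by simp
  then show "\<forall>x\<in>X. v x = 0"
    using u(2) assms(3) by (metis subsetD)
qed

text \<open>
  Choose \<open>v = e\<^sub>x\<^sub>0 + h\<close> with \<open>h\<close> carried by \<open>X\<close> so that \<open>A\<^sub>[\<^sub>\<Lambda>\<^sub>] v\<close> vanishes on \<open>X\<close>. Its value at \<open>x0\<close> is
  the Schur complement, and the extension of \<open>v\<close> converts these entries into values of \<open>A u\<close>.
\<close>
lemma equilibrium:
  assumes "finite \<Lambda>" and "\<Lambda> \<subseteq> E" and "X \<subseteq> \<Lambda>" and "x0 \<in> \<Lambda>" and "x0 \<notin> X"
  obtains u where "u \<in> l2 E" and "u x0 = 1" and "\<And>x. x \<in> \<Lambda> \<Longrightarrow> x \<notin> insert x0 X \<Longrightarrow> u x = 0"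
    and "\<And>x. x \<notin> \<Lambda> \<Longrightarrow> shifted u x = 0"
    and "\<And>x. x \<in> X \<Longrightarrow> A u x = 0"
    and "det_on (insert x0 X) (local_entry \<Lambda> (kernel_of E A)) =
      A u x0 * det_on X (local_entry \<Lambda> (kernel_of E A))"
proof -
  let ?B = "local_entry \<Lambda> (kernel_of E A)"
  have X: "finite X"
    using assms finite_subset by blast
  obtain h where h: "\<And>x. x \<notin> X \<Longrightarrow> h x = 0"
      "\<And>x. x \<in> X \<Longrightarrow> (\<Sum>y\<in>X. ?B x y * h y) = - ?B x x0"
    using solve_linear_system_on[OF X det_local_entry_nonzero[OF assms(1-3)], of "\<lambda>x. - ?B x x0"]
    by blast
  define v where "v x = (if x = x0 then 1 else h x)" for x
  have v_off: "v x = 0" if "x \<notin> insert x0 X" for x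
    using that h(1) by (simp add: v_def)
  have "(\<Sum>y\<in>X. ?B x y * v y) = (\<Sum>y\<in>X. ?B x y * h y)" for x
    by (rule sum.cong) (use assms(5) in \<open>auto simp: v_def\<close>)
  then have Bv: "(\<Sum>y\<in>insert x0 X. ?B x y * v y) = 0" if "x \<in> X" for x
    using X assms(5) h(2)[OF that] by (simp add: v_def)
  have sum_eq: "(\<Sum>y\<in>\<Lambda>. ?B x y * v y) = (\<Sum>y\<in>insert x0 X. ?B x y * v y)" for x
    by (rule sum.mono_neutral_right) (use assms v_off in auto)
  have v_off': "v x = 0" if "x \<notin> \<Lambda>" for x
    by (rule v_off) (use that assms(3,4) in auto)
  obtain u where u: "u \<in> l2 E" "\<And>x. x \<in> \<Lambda> \<Longrightarrow> u x = v x" "\<And>x. x \<notin> \<Lambda> \<Longrightarrow> shifted u x = 0"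
      "\<And>x. x \<in> \<Lambda> \<Longrightarrow> A u x = (\<Sum>y\<in>\<Lambda>. ?B x y * v y)"
    using local_extension[OF assms(1,2), of v] v_off' by blast
  show thesis
  proof (rule that[OF u(1)])
    show "u x0 = 1"
      using u(2) assms(4) by (simp add: v_def)
    show "u x = 0" if "x \<in> \<Lambda>" "x \<notin> insert x0 X" for x
      using u(2) v_off that by simp
    show "shifted u x = 0" if "x \<notin> \<Lambda>" for x
      using u(3) that .
    show "A u x = 0" if "x \<in> X" for x
      using u(4)[of x] sum_eq Bv[OF that] that assms(3) by auto
    have "det_on (insert x0 X) ?B = (\<Sum>y\<in>insert x0 X. ?B x0 y * v y) * det_on X ?B"
      by (rule det_on_insert_schur[OF X assms(5) _ Bv]) (simp_all add: v_def)
    then show "det_on (insert x0 X) ?B = A u x0 * det_on X ?B"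
      using u(4)[OF assms(4)] sum_eq by simp
  qed
qed

end

section \<open>Distance to the finitely supported functions\<close>

lemma F_loc_iff: "f \<in> F_loc \<Delta> \<longleftrightarrow> (\<exists>S. finite S \<and> S \<subseteq> \<Delta> \<and> (\<forall>x. x \<notin> S \<longrightarrow> f x = 0))"
proof
  assume "f \<in> F_loc \<Delta>"
  then obtain S c where S: "finite S" "S \<subseteq> \<Delta>" "f = (\<lambda>y. \<Sum>x\<in>S. c x * basis_fun x y)"
    unfolding F_loc_def by blast
  have "f y = 0" if "y \<notin> S" for y
    unfolding S(3) by (rule sum.neutral) (use that in \<open>auto simp: basis_fun_def\<close>)
  with S(1,2) show "\<exists>S. finite S \<and> S \<subseteq> \<Delta> \<and> (\<forall>x. x \<notin> S \<longrightarrow> f x = 0)"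
    by blast
next
  assume "\<exists>S. finite S \<and> S \<subseteq> \<Delta> \<and> (\<forall>x. x \<notin> S \<longrightarrow> f x = 0)"
  then obtain S where S: "finite S" "S \<subseteq> \<Delta>" "\<And>x. x \<notin> S \<Longrightarrow> f x = 0"
    by blast
  have "f y = (\<Sum>x\<in>S. f x * basis_fun x y)" for y
  proof -
    have "(\<Sum>x\<in>S. f x * basis_fun x y) = (\<Sum>x\<in>S. if x = y then f x else 0)"
      by (rule sum.cong) (auto simp: basis_fun_def)
    then show ?thesis
      using S by simp
  qed
  then have "f = (\<lambda>y. \<Sum>x\<in>S. f x * basis_fun x y)"
    by (rule ext)
  then show "f \<in> F_loc \<Delta>"
    unfolding F_loc_def using S(1,2) by blast
qed

lemma F_loc_zero: "(\<lambda>_. 0) \<in> F_loc \<Delta>"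
  by (auto simp: F_loc_iff)

lemma F_loc_mono: "\<Delta> \<subseteq> \<Delta>' \<Longrightarrow> F_loc \<Delta> \<subseteq> F_loc \<Delta>'"
  unfolding F_loc_iff subset_iff by blast

lemma F_loc_add_scaled:
  assumes "f \<in> F_loc \<Delta>" and "g \<in> F_loc \<Delta>"
  shows "(\<lambda>x. f x + c * g x) \<in> F_loc \<Delta>"
proof -
  obtain S T where "finite S" "S \<subseteq> \<Delta>" "\<forall>x. x \<notin> S \<longrightarrow> f x = 0"
    "finite T" "T \<subseteq> \<Delta>" "\<forall>x. x \<notin> T \<longrightarrow> g x = 0"
    using assms unfolding F_loc_iff by blast
  then have "finite (S \<union> T) \<and> S \<union> T \<subseteq> \<Delta> \<and> (\<forall>x. x \<notin> S \<union> T \<longrightarrow> f x + c * g x = 0)"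
    by simp
  then show ?thesis
    unfolding F_loc_iff by (rule exI)
qed

lemma F_loc_l2:
  assumes "f \<in> F_loc \<Delta>" and "\<Delta> \<subseteq> E"
  shows "f \<in> l2 E"
proof -
  obtain S where "finite S" "S \<subseteq> \<Delta>" "\<forall>x. x \<notin> S \<longrightarrow> f x = 0"
    using assms(1) unfolding F_loc_iff by blast
  then show ?thesis
    using assms(2) by (intro l2_finite_support[of S]) auto
qed

context positive_operator
begin

lemma energy_diff_le:
  assumes "f \<in> l2 E" and "g \<in> l2 E"
  shows "energy (\<lambda>x. f x - g x) (\<lambda>x. f x - g x) \<le> 2 * energy f f + 2 * energy g g"
proof -
  have "energy (\<lambda>x. f x + complex_of_real (-1) * g x) (\<lambda>x. f x + complex_of_real (-1) * g x) =
      energy f f - 2 * energy f g + energy g g"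
    by (subst energy_add_scaled[OF assms]) simp
  moreover have "0 \<le> energy (\<lambda>x. f x + complex_of_real 1 * g x) (\<lambda>x. f x + complex_of_real 1 * g x)"
    by (intro energy_nonneg l2_add(1) l2_scale assms)
  then have "0 \<le> energy f f + 2 * energy f g + energy g g"
    by (subst (asm) energy_add_scaled[OF assms]) simp
  ultimately show ?thesis
    by simp
qed

text \<open>
  Used in place of Cauchy-Schwarz to bound one energy from below: it is linear in the product of \<open>f\<close> and
  \<open>g\<close> and needs no division by an energy that may vanish.
\<close>
lemma energy_polarization_le:
  assumes "f \<in> l2 E" and "g \<in> l2 E"
  shows "2 * energy f g \<le> energy f f + energy g g"
proof -
  have "0 \<le> energy (\<lambda>x. f x + complex_of_real (-1) * g x) (\<lambda>x. f x + complex_of_real (-1) * g x)"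
    by (intro energy_nonneg l2_add(1) l2_scale assms)
  then show ?thesis
    by (subst (asm) energy_add_scaled[OF assms]) simp
qed

text \<open>
  At \<open>\<Delta> = \<xi>\<close> this single infimum over all finitely supported functions on \<open>\<xi>\<close> is the value of \<open>\<alpha>\<close>.
\<close>
definition dist_sq :: "'a \<Rightarrow> 'a set \<Rightarrow> real" where
  "dist_sq x0 \<Delta> = (INF f\<in>F_loc \<Delta>. energy (\<lambda>y. basis_fun x0 y - f y) (\<lambda>y. basis_fun x0 y - f y))"

lemma inf_sq_dist_eq:
  assumes "x0 \<in> E" and "\<xi> \<subseteq> E"
  shows "inf_sq_dist E A x0 \<xi> \<Lambda> = dist_sq x0 (\<Lambda> \<inter> \<xi>)"
  unfolding inf_sq_dist_def dist_sq_def
proof (rule INF_cong[OF refl])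
  fix f assume f: "f \<in> F_loc (\<Lambda> \<inter> \<xi>)"
  show "(minus_norm E A (\<lambda>y. basis_fun x0 y - f y))\<^sup>2 =
      energy (\<lambda>y. basis_fun x0 y - f y) (\<lambda>y. basis_fun x0 y - f y)"
    by (intro minus_norm_power2 l2_diff basis_fun_l2 assms(1) F_loc_l2[OF f]) (use assms(2) in blast)
qed

lemma dist_sq_le:
  assumes "x0 \<in> E" and "\<Delta> \<subseteq> E" and "f \<in> F_loc \<Delta>"
  shows "dist_sq x0 \<Delta> \<le> energy (\<lambda>y. basis_fun x0 y - f y) (\<lambda>y. basis_fun x0 y - f y)"
  unfolding dist_sq_def
proof (rule cINF_lower[OF _ assms(3)])
  show "bdd_below ((\<lambda>f. energy (\<lambda>y. basis_fun x0 y - f y) (\<lambda>y. basis_fun x0 y - f y)) ` F_loc \<Delta>)"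
    by (rule bdd_belowI2[where m = 0])
      (intro energy_nonneg l2_diff basis_fun_l2 assms(1) F_loc_l2[OF _ assms(2)])
qed

lemma dist_sq_approx:
  assumes "dist_sq x0 \<Delta> < c"
  obtains f where "f \<in> F_loc \<Delta>"
    and "energy (\<lambda>y. basis_fun x0 y - f y) (\<lambda>y. basis_fun x0 y - f y) < c"
proof -
  have "F_loc \<Delta> \<noteq> {}"
    using F_loc_zero by blast
  then show thesis
    using cInf_lessD[of "(\<lambda>f. energy (\<lambda>y. basis_fun x0 y - f y) (\<lambda>y. basis_fun x0 y - f y)) ` F_loc \<Delta>" c]
      assms that unfolding dist_sq_def by blast
qed

lemma dist_sq_antimono:
  assumes "x0 \<in> E" and "\<Delta> \<subseteq> \<Delta>'" and "\<Delta>' \<subseteq> E"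
  shows "dist_sq x0 \<Delta>' \<le> dist_sq x0 \<Delta>"
proof (rule ccontr)
  assume "\<not> ?thesis"
  then obtain f where f: "f \<in> F_loc \<Delta>"
      "energy (\<lambda>y. basis_fun x0 y - f y) (\<lambda>y. basis_fun x0 y - f y) < dist_sq x0 \<Delta>'"
    using dist_sq_approx[of x0 \<Delta> "dist_sq x0 \<Delta>'"] by auto
  then show False
    using dist_sq_le[OF assms(1,3), of f] F_loc_mono[OF assms(2)] by auto
qed

text \<open>
  A function of finite support on \<open>\<xi>\<close> is available as a competitor as soon as \<open>\<Lambda>\<close> contains its support.
\<close>
lemma dist_sq_tendsto:
  assumes "x0 \<in> E" and "\<xi> \<subseteq> E"
  shows "((\<lambda>\<Lambda>. dist_sq x0 (\<Lambda> \<inter> \<xi>)) \<longlongrightarrow> dist_sq x0 \<xi>) (finite_subsets_at_top E)"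
proof (rule decreasing_tendsto)
  show "\<forall>\<^sub>F \<Lambda> in finite_subsets_at_top E. dist_sq x0 \<xi> \<le> dist_sq x0 (\<Lambda> \<inter> \<xi>)"
    by (intro always_eventually allI dist_sq_antimono assms) auto
  fix c assume "dist_sq x0 \<xi> < c"
  then obtain f where f: "f \<in> F_loc \<xi>"
      "energy (\<lambda>y. basis_fun x0 y - f y) (\<lambda>y. basis_fun x0 y - f y) < c"
    by (rule dist_sq_approx)
  obtain S where S: "finite S" "S \<subseteq> \<xi>" "\<forall>x. x \<notin> S \<longrightarrow> f x = 0"
    using f(1) unfolding F_loc_iff by blast
  have "dist_sq x0 (\<Lambda> \<inter> \<xi>) < c" if "S \<subseteq> \<Lambda>" for \<Lambda>
  proof -
    have "f \<in> F_loc (\<Lambda> \<inter> \<xi>)"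
      unfolding F_loc_iff using S that by blast
    then have "dist_sq x0 (\<Lambda> \<inter> \<xi>) \<le> energy (\<lambda>y. basis_fun x0 y - f y) (\<lambda>y. basis_fun x0 y - f y)"
      by (rule dist_sq_le[OF assms(1), rotated]) (use assms(2) in auto)
    with f(2) show ?thesis
      by simp
  qed
  then show "\<forall>\<^sub>F \<Lambda> in finite_subsets_at_top E. dist_sq x0 (\<Lambda> \<inter> \<xi>) < c"
    unfolding eventually_finite_subsets_at_top using S assms(2) by (intro exI[of _ S]) auto
qed

text \<open>
  Moving from \<open>r = e\<^sub>x\<^sub>0 - f\<close> to the competitor \<open>r + t d\<close> cannot lower the energy below the infimum, that is, by
  more than \<open>t\<^sup>2\<close>; dividing the resulting quadratic inequality by \<open>t\<close> gives the bound. Allowing an excess of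
  order \<open>t\<^sup>2\<close> balances the two error terms.
\<close>
lemma near_minimizer_almost_orthogonal:
  assumes "x0 \<in> E" and "\<xi> \<subseteq> E" and "f \<in> F_loc \<xi>" and "d \<in> F_loc \<xi>" and "0 < t"
    and "energy (\<lambda>y. basis_fun x0 y - f y) (\<lambda>y. basis_fun x0 y - f y) \<le> dist_sq x0 \<xi> + t\<^sup>2"
  shows "- t * (1 + energy d d) \<le> 2 * energy (\<lambda>y. basis_fun x0 y - f y) d"
proof -
  let ?r = "\<lambda>y. basis_fun x0 y - f y"
  have r: "?r \<in> l2 E" and d: "d \<in> l2 E"
    using F_loc_l2[OF assms(3,2)] F_loc_l2[OF assms(4,2)] basis_fun_l2[OF assms(1)]
    by (simp_all add: l2_diff)
  have "dist_sq x0 \<xi> \<le> energy (\<lambda>x. ?r x + complex_of_real t * d x) (\<lambda>x. ?r x + complex_of_real t * d x)"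
    using dist_sq_le[OF assms(1,2) F_loc_add_scaled[OF assms(3,4), of "- complex_of_real t"]]
    by (simp add: algebra_simps)
  also have "\<dots> = energy ?r ?r + 2 * t * energy ?r d + t\<^sup>2 * energy d d"
    by (rule energy_add_scaled[OF r d])
  finally have "0 \<le> t\<^sup>2 + 2 * t * energy ?r d + t\<^sup>2 * energy d d"
    using assms(6) by simp
  also have "\<dots> = t * (t * (1 + energy d d) + 2 * energy ?r d)"
    by (simp add: power2_eq_square algebra_simps)
  finally show ?thesis
    using assms(5) by (simp add: zero_le_mult_iff)
qed

end

section \<open>Energy bounds for the equilibrium extension\<close>

text \<open>
  The properties of \<open>u\<close> obtained in \<open>equilibrium\<close>, apart from the determinants: everything about the size of
  \<open>(A u) x0\<close> follows from them.
\<close>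
locale equilibrium_extension = positive_operator +
  fixes \<Lambda> X :: "'a set" and x0 :: 'a and u :: "'a \<Rightarrow> complex"
  assumes finite_volume: "finite \<Lambda>" and volume_subset: "\<Lambda> \<subseteq> E"
    and X_subset: "X \<subseteq> \<Lambda>" and x0_in: "x0 \<in> \<Lambda>" and x0_notin: "x0 \<notin> X"
    and u_l2: "u \<in> l2 E" and u_x0: "u x0 = 1"
    and u_zero: "\<And>x. x \<in> \<Lambda> \<Longrightarrow> x \<notin> insert x0 X \<Longrightarrow> u x = 0"
    and u_outside: "\<And>x. x \<notin> \<Lambda> \<Longrightarrow> shifted u x = 0"
    and Au_zero: "\<And>x. x \<in> X \<Longrightarrow> A u x = 0"
begin

text \<open>
  On \<open>\<Lambda>\<close> the function \<open>g\<close> lives on \<open>X \<union> {x0}\<close> and \<open>A u\<close> vanishes on \<open>X\<close>, so only \<open>x0\<close> contributes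
  inside \<open>\<Lambda>\<close>.
\<close>
lemma energy_equilibrium:
  assumes "g \<in> l2 E" and "g x0 = 1" and "\<And>x. x \<in> \<Lambda> \<Longrightarrow> x \<notin> insert x0 X \<Longrightarrow> g x = 0"
  shows "energy g u = Re (A u x0) - Re (l2_inner E g (coord_proj (E - \<Lambda>) u))"
proof -
  have "(\<Sum>x\<in>\<Lambda>. cnj (g x) * A u x) = (\<Sum>x\<in>{x0}. cnj (g x) * A u x)"
  proof (rule sum.mono_neutral_right[OF finite_volume])
    show "{x0} \<subseteq> \<Lambda>"
      using x0_in by simp
    show "\<forall>x\<in>\<Lambda> - {x0}. cnj (g x) * A u x = 0"
    proof
      fix x assume "x \<in> \<Lambda> - {x0}"
      then show "cnj (g x) * A u x = 0"
        using assms(3)[of x] Au_zero[of x] by (cases "x \<in> X") auto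
    qed
  qed
  moreover have "energy g u =
      Re (\<Sum>x\<in>\<Lambda>. cnj (g x) * A u x) - Re (l2_inner E g (coord_proj (E - \<Lambda>) u))"
    by (rule energy_local_extension[OF finite_volume volume_subset assms(1) u_l2]) (rule u_outside)
  ultimately show ?thesis
    using assms(2) by simp
qed

lemma equilibrium_value:
  "energy u u + (l2_norm E (coord_proj (E - \<Lambda>) u))\<^sup>2 = Re (A u x0)"
proof -
  have "energy u u = Re (A u x0) - Re (l2_inner E u (coord_proj (E - \<Lambda>) u))"
    by (rule energy_equilibrium[OF u_l2 u_x0]) (rule u_zero)
  then show ?thesis
    by (simp add: l2_inner_coord_proj_self[OF u_l2])
qed

text \<open>
  The competitor \<open>e\<^sub>x\<^sub>0 - f\<close> does not meet the outer part of \<open>u\<close>, so its energy product with \<open>u\<close> is \<open>(A u) x0\<close>,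
  which is at least the energy of \<open>u\<close> itself; comparing squares gives the claim.
\<close>
lemma equilibrium_value_le:
  assumes "f \<in> F_loc X"
  shows "Re (A u x0) \<le> energy (\<lambda>y. basis_fun x0 y - f y) (\<lambda>y. basis_fun x0 y - f y)"
proof -
  let ?r = "\<lambda>y. basis_fun x0 y - f y"
  obtain S where S: "finite S" "S \<subseteq> X" "\<forall>x. x \<notin> S \<longrightarrow> f x = 0"
    using assms unfolding F_loc_iff by blast
  have f_off: "f x = 0" if "x \<notin> X" for x
    using S that by blast
  have r: "?r \<in> l2 E"
    by (intro l2_diff basis_fun_l2 F_loc_l2[OF assms]) (use X_subset volume_subset x0_in in auto)
  have "l2_inner E ?r (coord_proj (E - \<Lambda>) u) = (\<Sum>x\<in>{}. cnj (?r x) * coord_proj (E - \<Lambda>) u x)"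
    by (rule l2_inner_finite_support)
      (use f_off X_subset x0_in in \<open>auto simp: coord_proj_def basis_fun_def\<close>)
  then have "energy ?r u = Re (A u x0)"
    using energy_equilibrium[OF r] f_off x0_notin by (simp add: basis_fun_def)
  then have "2 * Re (A u x0) \<le> energy ?r ?r + energy u u"
    using energy_polarization_le[OF r u_l2] by simp
  then show ?thesis
    using equilibrium_value by (smt (verit) zero_le_power2)
qed

text \<open>
  Here \<open>r = e\<^sub>x\<^sub>0 - f\<close> is nearly minimal and \<open>p\<close> is the part of \<open>u\<close> outside \<open>\<Lambda>\<close>. Since \<open>u - p\<close> is \<open>e\<^sub>x\<^sub>0\<close>
  minus a function carried by \<open>X\<close>, the difference \<open>d = u - p - r\<close> is finitely supported on \<open>\<xi>\<close>, and in the
  energy product of \<open>r\<close> with \<open>u = r + d + p\<close> the term with \<open>d\<close> is controlled by near-minimality and the term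
  with \<open>p\<close> by the tail of \<open>A r\<close>. The bounds on the energies involve only the energy \<open>Q\<close> of \<open>e\<^sub>x\<^sub>0\<close> and
  the norm bound \<open>C\<close> of \<open>A\<close>, so they are uniform in \<open>\<Lambda>\<close>.
\<close>
lemma equilibrium_value_ge:
  assumes "\<xi> \<subseteq> E" and "X \<subseteq> \<xi>" and "f \<in> F_loc \<xi>" and "0 < t" and "t \<le> 1"
    and near: "energy (\<lambda>y. basis_fun x0 y - f y) (\<lambda>y. basis_fun x0 y - f y) \<le> dist_sq x0 \<xi> + t\<^sup>2"
    and C: "0 \<le> C" "\<And>f. f \<in> l2 E \<Longrightarrow> l2_norm E (A f) \<le> C * l2_norm E f"
    and Q: "Q = energy (basis_fun x0) (basis_fun x0)"
  shows "dist_sq x0 \<xi> - t * (1 + (8 * Q + 4 + 2 * (C * Q)))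
      - 2 * (sqrt Q * l2_norm E (coord_proj (E - \<Lambda>) (A (\<lambda>y. basis_fun x0 y - f y))))
    \<le> Re (A u x0)"
proof -
  define r where "r y = basis_fun x0 y - f y" for y
  define p where "p = coord_proj (E - \<Lambda>) u"
  define d where "d y = (u y - r y) - p y" for y
  have x0_E: "x0 \<in> E"
    using x0_in volume_subset by blast
  have r: "r \<in> l2 E"
    unfolding r_def using F_loc_l2[OF assms(3,1)] basis_fun_l2[OF x0_E] by (intro l2_diff)
  have p: "p \<in> l2 E"
    unfolding p_def by (rule coord_proj_l2[OF u_l2])
  have ur: "(\<lambda>y. u y - r y) \<in> l2 E"
    by (rule l2_diff[OF u_l2 r])
  have d: "d \<in> l2 E"
    unfolding d_def by (rule l2_diff[OF ur p])
  have near': "energy r r \<le> dist_sq x0 \<xi> + t\<^sup>2"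
    using near unfolding r_def .
  have value_le: "Re (A u x0) \<le> Q"
    using equilibrium_value_le[OF F_loc_zero] Q by simp
  have dist_le: "dist_sq x0 \<xi> \<le> Q"
    using dist_sq_le[OF x0_E assms(1) F_loc_zero] Q by simp
  have "t\<^sup>2 \<le> 1"
    using assms(4,5) by (simp add: power_le_one)
  then have rr_le: "energy r r \<le> Q + 1"
    using near' dist_le by simp
  have uu_le: "energy u u \<le> Q" and pp_le: "(l2_norm E p)\<^sup>2 \<le> Q"
    using equilibrium_value value_le energy_nonneg[OF u_l2] zero_le_power2[of "l2_norm E p"]
    unfolding p_def by linarith+
  have energy_p_le: "energy p p \<le> C * Q"
  proof -
    have "energy p p \<le> l2_norm E p * l2_norm E (A p)"
      using l2_cauchy_schwarz[OF p op_l2[OF p]] by (simp add: energy_def)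
    also have "\<dots> \<le> l2_norm E p * (C * l2_norm E p)"
      by (intro mult_left_mono C(2) p) simp
    also have "\<dots> = C * (l2_norm E p)\<^sup>2"
      by (simp add: power2_eq_square)
    also have "\<dots> \<le> C * Q"
      by (intro mult_left_mono pp_le C(1))
    finally show ?thesis .
  qed
  have "d \<in> F_loc \<xi>"
  proof -
    obtain S where S: "finite S" "S \<subseteq> \<xi>" "\<forall>x. x \<notin> S \<longrightarrow> f x = 0"
      using assms(3) unfolding F_loc_iff by blast
    have "d x = 0" if x: "x \<notin> X \<union> S" for x
    proof (cases "x \<in> \<Lambda>")
      case True
      then show ?thesis
        using x S(3) u_x0 u_zero[of x] by (auto simp: d_def r_def p_def coord_proj_def basis_fun_def)
    next
      case False
      then show ?thesis
        using x S(3) x0_in u_l2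
        by (auto simp: d_def r_def p_def coord_proj_def basis_fun_def l2_def)
    qed
    moreover have "finite X"
      using X_subset finite_volume finite_subset by blast
    ultimately show ?thesis
      unfolding F_loc_iff using S(1,2) assms(2) by (intro exI[of _ "X \<union> S"]) auto
  qed
  then have "- t * (1 + energy d d) \<le> 2 * energy r d"
    unfolding r_def by (rule near_minimizer_almost_orthogonal[OF x0_E assms(1,3) _ assms(4) near])
  moreover have "t * (1 + energy d d) \<le> t * (1 + (8 * Q + 4 + 2 * (C * Q)))"
  proof -
    \<comment> \<open>the energies of \<open>u\<close>, \<open>r\<close>, \<open>p\<close> are at most \<open>Q\<close>, \<open>Q + 1\<close>, \<open>C Q\<close>\<close>
    have "energy d d \<le> 2 * energy (\<lambda>y. u y - r y) (\<lambda>y. u y - r y) + 2 * energy p p"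
      unfolding d_def by (rule energy_diff_le[OF ur p])
    moreover have "energy (\<lambda>y. u y - r y) (\<lambda>y. u y - r y) \<le> 2 * energy u u + 2 * energy r r"
      by (rule energy_diff_le[OF u_l2 r])
    ultimately have "energy d d \<le> 8 * Q + 4 + 2 * (C * Q)"
      using uu_le rr_le energy_p_le by linarith
    then show ?thesis
      using assms(4) by simp
  qed
  moreover have "- (sqrt Q * l2_norm E (coord_proj (E - \<Lambda>) (A r))) \<le> energy r p"
  proof -
    have "l2_inner E p (A r) = l2_inner E p (coord_proj (E - \<Lambda>) (A r))"
      unfolding l2_inner_def p_def by (rule infsum_cong) (auto simp: coord_proj_def)
    then have "\<bar>energy r p\<bar> \<le> l2_norm E p * l2_norm E (coord_proj (E - \<Lambda>) (A r))"
      using l2_cauchy_schwarz[OF p coord_proj_l2[OF op_l2[OF r]]] energy_commute[OF r p]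
      by (simp add: energy_def)
    also have "\<dots> \<le> sqrt Q * l2_norm E (coord_proj (E - \<Lambda>) (A r))"
      by (intro mult_right_mono real_le_rsqrt pp_le) simp
    finally show ?thesis
      by linarith
  qed
  moreover have "energy r u = energy r r + energy r d + energy r p"
  proof -
    have "energy r d = energy r u - energy r r - energy r p"
      unfolding d_def by (simp add: energy_diff_right u_l2 r ur p)
    then show ?thesis
      by simp
  qed
  moreover have "2 * energy r u \<le> energy r r + energy u u"
    by (rule energy_polarization_le[OF r u_l2])
  moreover have "energy u u \<le> Re (A u x0)"
    using equilibrium_value by (smt (verit) zero_le_power2)
  moreover have "dist_sq x0 \<xi> \<le> energy r r"
    using dist_sq_le[OF x0_E assms(1,3)] unfolding r_def .
  ultimately have "dist_sq x0 \<xi> - t * (1 + (8 * Q + 4 + 2 * (C * Q)))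
      - 2 * (sqrt Q * l2_norm E (coord_proj (E - \<Lambda>) (A r))) \<le> Re (A u x0)"
    by linarith
  then show ?thesis
    unfolding r_def .
qed

end

section \<open>The limit\<close>

context injective_positive_operator
begin

lemma cylinder_prob_nonzero:
  assumes "determinantal_process E (kernel_of E A) \<mu>"
    and "finite \<Lambda>" and "\<Lambda> \<subseteq> E" and "X \<subseteq> \<Lambda>"
  shows "cylinder_prob E \<mu> \<Lambda> X \<noteq> 0"
  using cylinder_prob_eq[OF assms] det_resolvent_nonzero[OF assms(2,3)]
    det_local_entry_nonzero[OF assms(2-4)] by auto

lemma alpha_loc_eq:
  assumes "determinantal_process E (kernel_of E A) \<mu>"
    and "finite \<Lambda>" and "\<Lambda> \<subseteq> E" and "x0 \<in> \<Lambda>"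
  shows "complex_of_real (alpha_loc E \<mu> x0 \<xi> \<Lambda>) =
    det_on ({x0} \<union> (\<xi> \<inter> \<Lambda>)) (local_entry \<Lambda> (kernel_of E A)) /
    det_on (\<xi> \<inter> \<Lambda>) (local_entry \<Lambda> (kernel_of E A))"
  using cylinder_prob_eq[OF assms(1-3), of "{x0} \<union> (\<xi> \<inter> \<Lambda>)"]
    cylinder_prob_eq[OF assms(1-3), of "\<xi> \<inter> \<Lambda>"] det_resolvent_nonzero[OF assms(2,3)] assms(4)
  by (simp add: alpha_loc_def)

lemma alpha_loc_equilibrium:
  assumes "determinantal_process E (kernel_of E A) \<mu>"
    and "finite \<Lambda>" and "\<Lambda> \<subseteq> E" and "x0 \<in> \<Lambda>" and "x0 \<notin> \<xi>"
  obtains u where "equilibrium_extension E A \<Lambda> (\<xi> \<inter> \<Lambda>) x0 u"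
    and "Re (A u x0) = alpha_loc E \<mu> x0 \<xi> \<Lambda>"
proof -
  let ?X = "\<xi> \<inter> \<Lambda>" and ?B = "local_entry \<Lambda> (kernel_of E A)"
  obtain u where u: "u \<in> l2 E" "u x0 = 1"
      "\<And>x. x \<in> \<Lambda> \<Longrightarrow> x \<notin> insert x0 ?X \<Longrightarrow> u x = 0"
      "\<And>x. x \<notin> \<Lambda> \<Longrightarrow> shifted u x = 0" "\<And>x. x \<in> ?X \<Longrightarrow> A u x = 0"
      "det_on (insert x0 ?X) ?B = A u x0 * det_on ?X ?B"
    using equilibrium[OF assms(2,3), of ?X x0] assms(4,5) by blast
  have "complex_of_real (alpha_loc E \<mu> x0 \<xi> \<Lambda>) = A u x0"
    using alpha_loc_eq[OF assms(1-4), of \<xi>] u(6) det_local_entry_nonzero[OF assms(2,3), of ?X]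
    by simp
  then have "Re (A u x0) = alpha_loc E \<mu> x0 \<xi> \<Lambda>"
    by (metis Re_complex_of_real)
  moreover have "equilibrium_extension E A \<Lambda> ?X x0 u"
    by unfold_locales (use assms u in auto)
  ultimately show thesis
    using that by blast
qed

text \<open>
  In the lower bound the accuracy \<open>t\<close> of the near-minimizer is fixed first, small against the gap
  \<open>dist_sq x0 \<xi> - c\<close>; this fixes the near-minimizer, and then \<open>\<Lambda>\<close> grows until the tail of \<open>A r\<close> is small
  enough.
\<close>
lemma alpha_loc_tendsto:
  assumes "determinantal_process E (kernel_of E A) \<mu>"
    and "x0 \<in> E" and "\<xi> \<subseteq> E" and "x0 \<notin> \<xi>"
  shows "(alpha_loc E \<mu> x0 \<xi> \<longlongrightarrow> dist_sq x0 \<xi>) (finite_subsets_at_top E)"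
proof (rule order_tendstoI)
  let ?F = "finite_subsets_at_top E"
  have large: "\<forall>\<^sub>F \<Lambda> in ?F. finite \<Lambda> \<and> \<Lambda> \<subseteq> E \<and> x0 \<in> \<Lambda>"
    unfolding eventually_finite_subsets_at_top using assms(2) by (intro exI[of _ "{x0}"]) auto
  show "\<forall>\<^sub>F \<Lambda> in ?F. alpha_loc E \<mu> x0 \<xi> \<Lambda> < c" if c: "dist_sq x0 \<xi> < c" for c
  proof -
    have "\<forall>\<^sub>F \<Lambda> in ?F. dist_sq x0 (\<Lambda> \<inter> \<xi>) < c"
      using order_tendstoD(2)[OF dist_sq_tendsto[OF assms(2,3)] c] .
    with large show ?thesis
    proof eventually_elim
      case (elim \<Lambda>)
      then obtain u where u: "equilibrium_extension E A \<Lambda> (\<xi> \<inter> \<Lambda>) x0 u"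
          "Re (A u x0) = alpha_loc E \<mu> x0 \<xi> \<Lambda>"
        using alpha_loc_equilibrium[OF assms(1), of \<Lambda> x0 \<xi>] assms(4) by blast
      obtain f where f: "f \<in> F_loc (\<Lambda> \<inter> \<xi>)"
          "energy (\<lambda>y. basis_fun x0 y - f y) (\<lambda>y. basis_fun x0 y - f y) < c"
        using elim dist_sq_approx by blast
      then show ?case
        using equilibrium_extension.equilibrium_value_le[OF u(1), of f] u(2)
        by (simp add: Int_commute)
    qed
  qed
  show "\<forall>\<^sub>F \<Lambda> in ?F. c < alpha_loc E \<mu> x0 \<xi> \<Lambda>" if c: "c < dist_sq x0 \<xi>" for c
  proof -
    define Q where "Q = energy (basis_fun x0) (basis_fun x0)"
    obtain C where C: "0 \<le> C" "\<And>f. f \<in> l2 E \<Longrightarrow> l2_norm E (A f) \<le> C * l2_norm E f"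
      using op_norm_bound by blast
    define D where "D = 1 + (8 * Q + 4 + 2 * (C * Q))"
    have "0 \<le> Q"
      unfolding Q_def by (intro energy_nonneg basis_fun_l2 assms(2))
    then have D: "0 < D"
      using C(1) by (simp add: D_def add_pos_nonneg)
    \<comment> \<open>half of the gap is spent on the term with \<open>D\<close>, half on the tail; the energy bounds need \<open>t \<le> 1\<close>\<close>
    define t where "t = min 1 ((dist_sq x0 \<xi> - c) / (2 * D))"
    have t: "0 < t" "t \<le> 1"
      using c D by (simp_all add: t_def)
    have "t \<le> (dist_sq x0 \<xi> - c) / (2 * D)"
      by (simp add: t_def)
    then have tD: "2 * (t * D) \<le> dist_sq x0 \<xi> - c"
      using D by (simp add: field_simps)
    obtain f where f: "f \<in> F_loc \<xi>"
        "energy (\<lambda>y. basis_fun x0 y - f y) (\<lambda>y. basis_fun x0 y - f y) < dist_sq x0 \<xi> + t\<^sup>2"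
      using dist_sq_approx[of x0 \<xi> "dist_sq x0 \<xi> + t\<^sup>2"] t(1) by auto
    let ?tail = "\<lambda>\<Lambda>. l2_norm E (coord_proj (E - \<Lambda>) (A (\<lambda>y. basis_fun x0 y - f y)))"
    have "(?tail \<longlongrightarrow> 0) ?F"
      by (intro l2_tail_tendsto_zero op_l2 l2_diff basis_fun_l2 assms(2) F_loc_l2[OF f(1) assms(3)])
    then have "((\<lambda>\<Lambda>. 4 * (sqrt Q * ?tail \<Lambda>)) \<longlongrightarrow> 4 * (sqrt Q * 0)) ?F"
      by (intro tendsto_intros)
    then have "\<forall>\<^sub>F \<Lambda> in ?F. 4 * (sqrt Q * ?tail \<Lambda>) < dist_sq x0 \<xi> - c"
      by (rule order_tendstoD(2)) (use c in simp)
    with large show ?thesis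
    proof eventually_elim
      case (elim \<Lambda>)
      then obtain u where u: "equilibrium_extension E A \<Lambda> (\<xi> \<inter> \<Lambda>) x0 u"
          "Re (A u x0) = alpha_loc E \<mu> x0 \<xi> \<Lambda>"
        using alpha_loc_equilibrium[OF assms(1), of \<Lambda> x0 \<xi>] assms(4) by blast
      have "dist_sq x0 \<xi> - t * D - 2 * (sqrt Q * ?tail \<Lambda>) \<le> Re (A u x0)"
        unfolding D_def
        by (rule equilibrium_extension.equilibrium_value_ge[OF u(1) assms(3) _ f(1) t less_imp_le[OF f(2)] C Q_def])
          auto
      then show ?case
        using u(2) elim tD by linarith
    qed
  qed
qed

end

theorem theorem2p4:
  fixes E :: "'a set" and A :: "('a \<Rightarrow> complex) \<Rightarrow> ('a \<Rightarrow> complex)"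
    and \<mu> :: "'a set measure" and x0 :: 'a and \<xi> :: "'a set"
  assumes "countable E"
    and "hypothesis_H E A"
    and "determinantal_process E (kernel_of E A) \<mu>"
    and "x0 \<in> E" and "\<xi> \<subseteq> E" and "x0 \<notin> \<xi>"
  shows "(\<forall>\<Lambda>. finite \<Lambda> \<and> \<Lambda> \<subseteq> E \<and> x0 \<in> \<Lambda> \<longrightarrow>
            cylinder_prob E \<mu> \<Lambda> (\<xi> \<inter> \<Lambda>) \<noteq> 0 \<and>
            det_on (\<xi> \<inter> \<Lambda>) (local_entry \<Lambda> (kernel_of E A)) \<noteq> 0 \<and>
            complex_of_real (alpha_loc E \<mu> x0 \<xi> \<Lambda>) =
              det_on ({x0} \<union> (\<xi> \<inter> \<Lambda>)) (local_entry \<Lambda> (kernel_of E A)) /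
              det_on (\<xi> \<inter> \<Lambda>) (local_entry \<Lambda> (kernel_of E A))) \<and>
         (inf_sq_dist E A x0 \<xi> \<longlongrightarrow> alpha E A x0 \<xi>) (finite_subsets_at_top E) \<and>
         (alpha_loc E \<mu> x0 \<xi> \<longlongrightarrow> alpha E A x0 \<xi>) (finite_subsets_at_top E)"
proof -
  interpret injective_positive_operator E A
    by unfold_locales (use assms(2) in \<open>simp_all add: hypothesis_H_def\<close>)
  have "inf_sq_dist E A x0 \<xi> = (\<lambda>\<Lambda>. dist_sq x0 (\<Lambda> \<inter> \<xi>))"
    by (rule ext) (rule inf_sq_dist_eq[OF assms(4,5)])
  then have dist: "(inf_sq_dist E A x0 \<xi> \<longlongrightarrow> dist_sq x0 \<xi>) (finite_subsets_at_top E)"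
    using dist_sq_tendsto[OF assms(4,5)] by simp
  then have alpha: "alpha E A x0 \<xi> = dist_sq x0 \<xi>"
    unfolding alpha_def by (intro tendsto_Lim finite_subsets_at_top_neq_bot)
  show ?thesis
  proof (intro conjI allI impI)
    fix \<Lambda> assume \<Lambda>: "finite \<Lambda> \<and> \<Lambda> \<subseteq> E \<and> x0 \<in> \<Lambda>"
    show "cylinder_prob E \<mu> \<Lambda> (\<xi> \<inter> \<Lambda>) \<noteq> 0"
      by (rule cylinder_prob_nonzero[OF assms(3)]) (use \<Lambda> in auto)
    show "det_on (\<xi> \<inter> \<Lambda>) (local_entry \<Lambda> (kernel_of E A)) \<noteq> 0"
      by (rule det_local_entry_nonzero) (use \<Lambda> in auto)
    show "complex_of_real (alpha_loc E \<mu> x0 \<xi> \<Lambda>) =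
        det_on ({x0} \<union> (\<xi> \<inter> \<Lambda>)) (local_entry \<Lambda> (kernel_of E A)) /
        det_on (\<xi> \<inter> \<Lambda>) (local_entry \<Lambda> (kernel_of E A))"
      by (rule alpha_loc_eq[OF assms(3)]) (use \<Lambda> in auto)
  next
    show "(inf_sq_dist E A x0 \<xi> \<longlongrightarrow> alpha E A x0 \<xi>) (finite_subsets_at_top E)"
      unfolding alpha by (rule dist)
    show "(alpha_loc E \<mu> x0 \<xi> \<longlongrightarrow> alpha E A x0 \<xi>) (finite_subsets_at_top E)"
      unfolding alpha by (rule alpha_loc_tendsto[OF assms(3-6)])
  qed
qed

end
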